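(* Let $A_1$ and $B_1$ be finite-dimensional $\mathbb K$-vector spaces, and let $A=T(A_1)$ and $B=T(B_1)$ be the associated tensor algebras with the usual weight grading. Let $\{u_1,\dots,u_m,d_1,\dots,d_n\}$ be a basis of $B_1$, and let $B_1'=\mathrm{span}\{u_1,\dots,u_m\}$, $B_1''=\mathrm{span}\{d_1,\dots,d_n\}$. Suppose that $t:B_1\otimes A_1\to A\otimes B$ is a linear map such that $$t(B_1'\otimes A_1)\subseteq A_1\otimes B_1'\oplus A_2\otimes B_0\quad\text{and}\quad t(B_1''\otimes A_1)\subseteq A_1\otimes B_1''\oplus A_0\otimes\mu_B(B_1\otimes B_1'').$$ Then there exists a graded twisting map $\tau:B\otimes A\to A\otimes B$ such that $\tau|_{B_1\otimes A_1}=t$.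
   Context: $\mathbb K$ is a field, $\otimes=\otimes_{\mathbb K}$. $\mu_A,\mu_B$ are the multiplications; $1_A$ also denotes the identity map of $A$. $A\otimes B$ and $B\otimes A$ are graded by $(V\otimes W)_m=\bigoplus_{k+l=m}V_k\otimes W_l$, and a linear map is graded if it preserves degree. A graded twisting map is a graded linear map $\tau:B\otimes A\to A\otimes B$ with $\tau(1_B\otimes a)=a\otimes 1_B$, $\tau(b\otimes 1_A)=1_A\otimes b$ for all $a\in A$, $b\in B$, and $\tau(\mu_B\otimes\mu_A)=(\mu_A\otimes\mu_B)(1_A\otimes\tau\otimes 1_B)(\tau\otimes\tau)(1_B\otimes\tau\otimes 1_A)$ on $B\otimes B\otimes A\otimes A$. *)

theory Defs
  imports Complex_Main "HOL-Library.Function_Algebras" "HOL-Library.Set_Algebras"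
begin

text \<open>
  All tensor products and tensor algebras below are realised as spaces of \<open>'k\<close>-valued functions,
  with pointwise operations. The \<open>+\<close> of two subspaces is the sum of sets from
  \<^theory>\<open>HOL-Library.Set_Algebras\<close>.
\<close>

definition fscale :: "'k::field \<Rightarrow> ('x \<Rightarrow> 'k) \<Rightarrow> 'x \<Rightarrow> 'k" where
  "fscale c f = (\<lambda>x. c * f x)"

global_interpretation fun_vs: vector_space "fscale :: 'k::field \<Rightarrow> ('x \<Rightarrow> 'k) \<Rightarrow> 'x \<Rightarrow> 'k"
  by unfold_locales (auto simp: fscale_def fun_eq_iff algebra_simps)

definition linear_on ::
  "('k \<Rightarrow> 'v \<Rightarrow> 'v) \<Rightarrow> ('k \<Rightarrow> 'w \<Rightarrow> 'w) \<Rightarrow> 'v::plus set \<Rightarrow> ('v \<Rightarrow> 'w::plus) \<Rightarrow> bool" where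
  "linear_on s1 s2 S f \<longleftrightarrow>
     (\<forall>x\<in>S. \<forall>y\<in>S. f (x + y) = f x + f y) \<and> (\<forall>c. \<forall>x\<in>S. f (s1 c x) = s2 c (f x))"


section \<open>Tensor products of function spaces\<close>

text \<open>
  For subspaces \<open>V\<close> of \<open>'x \<Rightarrow> 'k\<close> and \<open>W\<close> of \<open>'y \<Rightarrow> 'k\<close>, the span of the functions
  \<open>(x, y) \<mapsto> v x * w y\<close> is a tensor product of \<open>V\<close> and \<open>W\<close>: the universal property
  is proved below (\<open>tensor_universal\<close>, \<open>tensor_unique\<close>).
\<close>

definition tens :: "('x \<Rightarrow> 'k::field) \<Rightarrow> ('y \<Rightarrow> 'k) \<Rightarrow> ('x \<times> 'y) \<Rightarrow> 'k" (infixr "\<otimes>" 75) where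
  "v \<otimes> w = (\<lambda>(x, y). v x * w y)"

definition tensor_space ::
  "('x \<Rightarrow> 'k::field) set \<Rightarrow> ('y \<Rightarrow> 'k) set \<Rightarrow> (('x \<times> 'y) \<Rightarrow> 'k) set" (infixr "\<otimes>\<^sub>S" 75) where
  "V \<otimes>\<^sub>S W = fun_vs.span {v \<otimes> w | v w. v \<in> V \<and> w \<in> W}"

text \<open>The linear map \<open>f \<otimes> g\<close> on \<open>V \<otimes>\<^sub>S W\<close>; its values outside this space are irrelevant.\<close>

definition tensor_map ::
  "('x \<Rightarrow> 'k::field) set \<Rightarrow> ('y \<Rightarrow> 'k) set \<Rightarrow> (('x \<Rightarrow> 'k) \<Rightarrow> ('z \<Rightarrow> 'k)) \<Rightarrow> (('y \<Rightarrow> 'k) \<Rightarrow> ('w \<Rightarrow> 'k))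
    \<Rightarrow> (('x \<times> 'y) \<Rightarrow> 'k) \<Rightarrow> (('z \<times> 'w) \<Rightarrow> 'k)" where
  "tensor_map V W f g =
     (SOME h. linear_on fscale fscale (V \<otimes>\<^sub>S W) h \<and> (\<forall>v\<in>V. \<forall>w\<in>W. h (v \<otimes> w) = f v \<otimes> g w))"

text \<open>
  The associativity isomorphism \<open>(v \<otimes> w) \<otimes> (v' \<otimes> w') \<mapsto> v \<otimes> ((w \<otimes> v') \<otimes> w')\<close> and its inverse.
\<close>

definition reassoc :: "((('x \<times> 'y) \<times> ('z \<times> 'w)) \<Rightarrow> 'k) \<Rightarrow> ('x \<times> (('y \<times> 'z) \<times> 'w)) \<Rightarrow> 'k" where
  "reassoc h = (\<lambda>(x, ((y, z), w)). h ((x, y), (z, w)))"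

definition unreassoc :: "(('x \<times> (('y \<times> 'z) \<times> 'w)) \<Rightarrow> 'k) \<Rightarrow> (('x \<times> 'y) \<times> ('z \<times> 'w)) \<Rightarrow> 'k" where
  "unreassoc h = (\<lambda>((x, y), (z, w)). h (x, ((y, z), w)))"


section \<open>Graded algebras and twisting maps\<close>

text \<open>The multiplication of an algebra \<open>A\<close> is a map on \<open>A \<otimes>\<^sub>S A\<close>.\<close>

record ('x, 'k) graded_algebra =
  gcomp :: "nat \<Rightarrow> ('x \<Rightarrow> 'k) set"
  unit :: "'x \<Rightarrow> 'k"
  mult :: "(('x \<times> 'x) \<Rightarrow> 'k) \<Rightarrow> 'x \<Rightarrow> 'k"

definition carrier :: "('x, 'k::field) graded_algebra \<Rightarrow> ('x \<Rightarrow> 'k) set" where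
  "carrier A = fun_vs.span (\<Union>n. gcomp A n)"

definition tensor_comp ::
  "('x, 'k::field) graded_algebra \<Rightarrow> ('y, 'k) graded_algebra \<Rightarrow> nat \<Rightarrow> (('x \<times> 'y) \<Rightarrow> 'k) set" where
  "tensor_comp A B m = (\<Sum>(k, l)\<in>{(k, l). k + l = m}. gcomp A k \<otimes>\<^sub>S gcomp B l)"

definition graded_twisting_map ::
  "('x, 'k::field) graded_algebra \<Rightarrow> ('y, 'k) graded_algebra
    \<Rightarrow> ((('y \<times> 'x) \<Rightarrow> 'k) \<Rightarrow> ('x \<times> 'y) \<Rightarrow> 'k) \<Rightarrow> bool" where
  "graded_twisting_map A B \<tau> \<longleftrightarrow>
     (let \<A> = carrier A; \<B> = carrier B in
        \<tau> ` (\<B> \<otimes>\<^sub>S \<A>) \<subseteq> \<A> \<otimes>\<^sub>S \<B> \<and>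
        linear_on fscale fscale (\<B> \<otimes>\<^sub>S \<A>) \<tau> \<and>
        (\<forall>m. \<tau> ` tensor_comp B A m \<subseteq> tensor_comp A B m) \<and>
        (\<forall>a\<in>\<A>. \<tau> (unit B \<otimes> a) = a \<otimes> unit B) \<and>
        (\<forall>b\<in>\<B>. \<tau> (b \<otimes> unit A) = unit A \<otimes> b) \<and>
        (\<forall>z \<in> (\<B> \<otimes>\<^sub>S \<B>) \<otimes>\<^sub>S (\<A> \<otimes>\<^sub>S \<A>).
           \<tau> (tensor_map (\<B> \<otimes>\<^sub>S \<B>) (\<A> \<otimes>\<^sub>S \<A>) (mult B) (mult A) z) =
           (tensor_map (\<A> \<otimes>\<^sub>S \<A>) (\<B> \<otimes>\<^sub>S \<B>) (mult A) (mult B)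
            \<circ> unreassoc
            \<circ> tensor_map \<A> ((\<B> \<otimes>\<^sub>S \<A>) \<otimes>\<^sub>S \<B>) id (tensor_map (\<B> \<otimes>\<^sub>S \<A>) \<B> \<tau> id)
            \<circ> reassoc
            \<circ> tensor_map (\<B> \<otimes>\<^sub>S \<A>) (\<B> \<otimes>\<^sub>S \<A>) \<tau> \<tau>
            \<circ> unreassoc
            \<circ> tensor_map \<B> ((\<B> \<otimes>\<^sub>S \<A>) \<otimes>\<^sub>S \<A>) id (tensor_map (\<B> \<otimes>\<^sub>S \<A>) \<A> \<tau> id)
            \<circ> reassoc) z))"


section \<open>Tensor algebras\<close>

text \<open>
  The tensor \<open>v\<^sub>1 \<otimes> \<dots> \<otimes> v\<^sub>n\<close> of vectors \<open>v\<^sub>i\<close> of a vector space \<open>V\<close> is realised as the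
  multilinear function \<open>(\<phi>\<^sub>1, \<dots>, \<phi>\<^sub>n) \<mapsto> \<phi>\<^sub>1(v\<^sub>1) \<cdots> \<phi>\<^sub>n(v\<^sub>n)\<close> of \<open>n\<close> linear forms on \<open>V\<close>; it
  vanishes on lists that do not consist of exactly \<open>n\<close> linear forms, so that the sum of the
  graded components (and every sum of spaces of different bidegrees) is direct. The resulting algebra has
  the universal property of the tensor algebra (\<open>tensor_algebra_universal\<close>,
  \<open>tensor_algebra_unique\<close>).
\<close>

definition word :: "('k::field \<Rightarrow> 'v::ab_group_add \<Rightarrow> 'v) \<Rightarrow> 'v list \<Rightarrow> ('v \<Rightarrow> 'k) list \<Rightarrow> 'k" where
  "word s vs = (\<lambda>\<phi>s.
     if length \<phi>s = length vs \<and> (\<forall>\<phi>\<in>set \<phi>s. Vector_Spaces.linear s (*) \<phi>)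
     then prod_list (map2 (\<lambda>\<phi> v. \<phi> v) \<phi>s vs) else 0)"

text \<open>
  The linear map on the tensor square that sends \<open>f \<otimes> g\<close> to the concatenation product of \<open>f\<close>
  and \<open>g\<close>; in particular \<open>word s vs \<otimes> word s ws \<mapsto> word s (vs @ ws)\<close>.
\<close>

definition concat_mult :: "(('x list \<times> 'x list) \<Rightarrow> 'k::field) \<Rightarrow> 'x list \<Rightarrow> 'k" where
  "concat_mult h = (\<lambda>xs. \<Sum>i\<le>length xs. h (take i xs, drop i xs))"

definition tensor_algebra ::
  "('k::field \<Rightarrow> 'v::ab_group_add \<Rightarrow> 'v) \<Rightarrow> (('v \<Rightarrow> 'k) list, 'k) graded_algebra" where
  "tensor_algebra s =
     \<lparr> gcomp = (\<lambda>n. fun_vs.span {word s vs | vs. length vs = n}),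
       unit = word s [],
       mult = concat_mult \<rparr>"

text \<open>The image in degree \<open>1\<close> of the subspace of \<open>V\<close> spanned by a set of vectors.\<close>

definition degree1_span ::
  "('k::field \<Rightarrow> 'v::ab_group_add \<Rightarrow> 'v) \<Rightarrow> 'v set \<Rightarrow> (('v \<Rightarrow> 'k) list \<Rightarrow> 'k) set" where
  "degree1_span s X = (\<lambda>v. word s [v]) ` module.span s X"


section \<open>Universal properties\<close>

lemma linear_on_zero:
  assumes "linear_on fscale s S f" "x \<in> S" "vector_space s"
  shows "f 0 = 0"
proof -
  interpret vector_space s by fact
  have "f (fscale 0 x) = s 0 (f x)"
    using assms(1,2) unfolding linear_on_def by blast
  then show ?thesis by (simp add: zero_fun_def[symmetric])
qed

lemma tens_bilinear:
  "(f + g) \<otimes> h = f \<otimes> h + g \<otimes> h" "f \<otimes> (h + k) = f \<otimes> h + f \<otimes> k"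
  "fscale c f \<otimes> h = fscale c (f \<otimes> h)" "f \<otimes> fscale c h = fscale c (f \<otimes> h)"
  by (auto simp: tens_def fscale_def fun_eq_iff algebra_simps)

lemma tens_in_tensor_space: "v \<in> V \<Longrightarrow> w \<in> W \<Longrightarrow> v \<otimes> w \<in> V \<otimes>\<^sub>S W"
  unfolding tensor_space_def by (rule fun_vs.span_base) auto

lemma linear_on_span_eq:
  assumes "linear_on fscale s (fun_vs.span S) f" "linear_on fscale s (fun_vs.span S) g"
    and "vector_space s" and "\<And>x. x \<in> S \<Longrightarrow> f x = g x" and z: "z \<in> fun_vs.span S"
  shows "f z = g z"
proof -
  have "z \<in> fun_vs.span S \<and> f z = g z"
    using z
  proof (induction rule: fun_vs.span_induct_alt)
    case base
    then show ?case
      using linear_on_zero[OF assms(1) fun_vs.span_zero assms(3)]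
        linear_on_zero[OF assms(2) fun_vs.span_zero assms(3)] fun_vs.span_zero by metis
  next
    case (step c x y)
    then have "x \<in> fun_vs.span S" "fscale c x \<in> fun_vs.span S" "y \<in> fun_vs.span S"
      by (auto intro: fun_vs.span_base fun_vs.span_scale)
    then show ?case
      using assms(1,2,4) step unfolding linear_on_def by (metis fun_vs.span_add)
  qed
  then show ?thesis by simp
qed

theorem tensor_unique:
  assumes "linear_on fscale s (V \<otimes>\<^sub>S W) f" "linear_on fscale s (V \<otimes>\<^sub>S W) g"
    and "vector_space s" and "\<And>v w. v \<in> V \<Longrightarrow> w \<in> W \<Longrightarrow> f (v \<otimes> w) = g (v \<otimes> w)"
    and "z \<in> V \<otimes>\<^sub>S W"
  shows "f z = g z"
  by (rule linear_on_span_eq[of s "{v \<otimes> w | v w. v \<in> V \<and> w \<in> W}"])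
    (use assms in \<open>auto simp: tensor_space_def\<close>)

lemma vector_space_mult: "vector_space ((*) :: 'k::field \<Rightarrow> 'k \<Rightarrow> 'k)"
  by unfold_locales (auto simp: algebra_simps)

lemma linear_formsI:
  fixes s :: "'k::field \<Rightarrow> 'v::ab_group_add \<Rightarrow> 'v"
  assumes "vector_space s" "\<not> module.dependent s X" "x \<in> X"
  obtains \<phi> where "Vector_Spaces.linear s (*) \<phi>" "\<phi> x = 1" "\<And>y. y \<in> X \<Longrightarrow> y \<noteq> x \<Longrightarrow> \<phi> y = 0"
proof -
  interpret p: vector_space_pair s "(*) :: 'k \<Rightarrow> 'k \<Rightarrow> 'k"
    by (intro vector_space_pair.intro assms(1) vector_space_mult)
  obtain g where "Vector_Spaces.linear s (*) g" "\<forall>y\<in>X. g y = (if y = x then 1 else 0)"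
    using p.linear_independent_extend[OF assms(2), of "\<lambda>y. if y = x then 1 else 0"] by blast
  then show thesis using assms(3) that[of g] by auto
qed

lemma independentI_forms:
  fixes S :: "('x \<Rightarrow> 'k::field) set"
  assumes "\<And>a. a \<in> S \<Longrightarrow> \<exists>\<phi>. linear_on fscale (*) UNIV \<phi> \<and> \<phi> a \<noteq> 0 \<and> (\<forall>b\<in>S. b \<noteq> a \<longrightarrow> \<phi> b = 0)"
  shows "\<not> fun_vs.dependent S"
proof
  assume "fun_vs.dependent S"
  then obtain a where a: "a \<in> S" "a \<in> fun_vs.span (S - {a})"
    by (auto simp: fun_vs.dependent_def)
  obtain \<phi> where \<phi>: "linear_on fscale (*) UNIV \<phi>" "\<phi> a \<noteq> 0" "\<forall>b\<in>S. b \<noteq> a \<longrightarrow> \<phi> b = 0"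
    using assms[OF a(1)] by blast
  have "\<phi> a = 0"
    by (rule linear_on_span_eq[OF _ _ vector_space_mult _ a(2), of \<phi> "\<lambda>_. 0"])
      (use \<phi> in \<open>auto simp: linear_on_def\<close>)
  with \<phi>(2) show False by simp
qed

lemma linear_imp_linear_on: "Vector_Spaces.linear s1 s2 f \<Longrightarrow> linear_on s1 s2 S f"
  unfolding linear_on_def linear_iff_module_hom module_hom_def module_hom_axioms_def by blast

theorem tensor_universal:
  fixes \<beta> :: "('x \<Rightarrow> 'k::field) \<Rightarrow> ('y \<Rightarrow> 'k) \<Rightarrow> 'u::ab_group_add"
  assumes V: "fun_vs.subspace V" and W: "fun_vs.subspace W" and s: "vector_space s"
    and \<beta>1: "\<And>w. w \<in> W \<Longrightarrow> linear_on fscale s V (\<lambda>v. \<beta> v w)"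
    and \<beta>2: "\<And>v. v \<in> V \<Longrightarrow> linear_on fscale s W (\<beta> v)"
  shows "\<exists>f. linear_on fscale s (V \<otimes>\<^sub>S W) f \<and> (\<forall>v\<in>V. \<forall>w\<in>W. f (v \<otimes> w) = \<beta> v w)"
proof -
  obtain X where X: "X \<subseteq> V" "\<not> fun_vs.dependent X" "V \<subseteq> fun_vs.span X"
    by (rule fun_vs.maximal_independent_subset)
  obtain Y where Y: "Y \<subseteq> W" "\<not> fun_vs.dependent Y" "W \<subseteq> fun_vs.span Y"
    by (rule fun_vs.maximal_independent_subset)
  have sX: "fun_vs.span X = V" and sY: "fun_vs.span Y = W"
    using X Y fun_vs.span_minimal[OF X(1) V] fun_vs.span_minimal[OF Y(1) W] by blast+
  have dual: "\<exists>\<phi>. linear_on fscale (*) UNIV \<phi> \<and> \<phi> (x \<otimes> y) = 1 \<and>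
      (\<forall>x'\<in>X. \<forall>y'\<in>Y. (x', y') \<noteq> (x, y) \<longrightarrow> \<phi> (x' \<otimes> y') = 0)" if xy: "x \<in> X" "y \<in> Y" for x y
  proof -
    obtain p where p: "Vector_Spaces.linear fscale (*) p" "p x = 1"
        "\<And>z. z \<in> X \<Longrightarrow> z \<noteq> x \<Longrightarrow> p z = 0"
      using linear_formsI[OF fun_vs.vector_space_axioms X(2) xy(1)] by blast
    obtain q where q: "Vector_Spaces.linear fscale (*) q" "q y = 1"
        "\<And>z. z \<in> Y \<Longrightarrow> z \<noteq> y \<Longrightarrow> q z = 0"
      using linear_formsI[OF fun_vs.vector_space_axioms Y(2) xy(2)] by blast
    have pl: "p (f + g) = p f + p g" "p (fscale c f) = c * p f" for f g c
      using linear_imp_linear_on[OF p(1), of UNIV] by (auto simp: linear_on_def)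
    have ql: "q (f + g) = q f + q g" "q (fscale c f) = c * q f" for f g c
      using linear_imp_linear_on[OF q(1), of UNIV] by (auto simp: linear_on_def)
    define \<phi> where "\<phi> = (\<lambda>z. q (\<lambda>b. p (\<lambda>a. z (a, b))))"
    have \<phi>t: "\<phi> (v \<otimes> w) = p v * q w" for v w
    proof -
      have "(\<lambda>a. (v \<otimes> w) (a, b)) = fscale (w b) v" for b
        by (auto simp: tens_def fscale_def)
      then have "(\<lambda>b. p (\<lambda>a. (v \<otimes> w) (a, b))) = fscale (p v) w"
        by (simp only: pl(2)) (simp add: fscale_def mult.commute)
      then show ?thesis by (simp add: \<phi>_def ql)
    qed
    have "linear_on fscale (*) UNIV \<phi>"
      unfolding linear_on_def
    proof (intro conjI ballI allI)
      fix z z' :: "'x \<times> 'y \<Rightarrow> 'k"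
      have "(\<lambda>b. p (\<lambda>a. (z + z') (a, b))) = (\<lambda>b. p (\<lambda>a. z (a, b))) + (\<lambda>b. p (\<lambda>a. z' (a, b)))"
        unfolding plus_fun_def using pl(1) by (auto simp: plus_fun_def)
      then show "\<phi> (z + z') = \<phi> z + \<phi> z'" by (simp add: \<phi>_def ql)
    next
      fix c and z :: "'x \<times> 'y \<Rightarrow> 'k"
      have "(\<lambda>b. p (\<lambda>a. fscale c z (a, b))) = fscale c (\<lambda>b. p (\<lambda>a. z (a, b)))"
        using pl(2) by (auto simp: fscale_def)
      then show "\<phi> (fscale c z) = c * \<phi> z" by (simp add: \<phi>_def ql)
    qed
    then show ?thesis using \<phi>t p q by (intro exI[of _ \<phi>]) auto
  qed
  let ?S = "(\<lambda>(x, y). x \<otimes> y) ` (X \<times> Y)"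
  have inj: "inj_on (\<lambda>(x, y). x \<otimes> y) (X \<times> Y)"
  proof (rule inj_onI, clarify)
    fix x y x' y' assume *: "x \<in> X" "y \<in> Y" "x' \<in> X" "y' \<in> Y" "x \<otimes> y = x' \<otimes> y'"
    obtain \<phi> :: "('x \<times> 'y \<Rightarrow> 'k) \<Rightarrow> 'k" where "\<phi> (x \<otimes> y) = 1"
      "\<forall>x'\<in>X. \<forall>y'\<in>Y. (x', y') \<noteq> (x, y) \<longrightarrow> \<phi> (x' \<otimes> y') = 0"
      using dual[OF *(1,2)] by blast
    then show "x = x' \<and> y = y'" using * by (metis zero_neq_one prod.inject)
  qed
  have indep: "\<not> fun_vs.dependent ?S"
  proof (rule independentI_forms)
    fix a assume "a \<in> ?S"
    then obtain x y where xy: "x \<in> X" "y \<in> Y" "a = x \<otimes> y" by auto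
    obtain \<phi> :: "('x \<times> 'y \<Rightarrow> 'k) \<Rightarrow> 'k" where "linear_on fscale (*) UNIV \<phi>" "\<phi> (x \<otimes> y) = 1"
      "\<forall>x'\<in>X. \<forall>y'\<in>Y. (x', y') \<noteq> (x, y) \<longrightarrow> \<phi> (x' \<otimes> y') = 0"
      using dual[OF xy(1,2)] by blast
    then show "\<exists>\<phi>. linear_on fscale (*) UNIV \<phi> \<and> \<phi> a \<noteq> 0 \<and> (\<forall>b\<in>?S. b \<noteq> a \<longrightarrow> \<phi> b = 0)"
      using xy by (intro exI[of _ \<phi>]) fastforce
  qed
  interpret s: vector_space s by fact
  interpret P: vector_space_pair "fscale :: 'k \<Rightarrow> ('x \<times> 'y \<Rightarrow> 'k) \<Rightarrow> _" s by unfold_locales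
  obtain g where g: "Vector_Spaces.linear fscale s g"
    "\<forall>z\<in>?S. g z = (case the_inv_into (X \<times> Y) (\<lambda>(x, y). x \<otimes> y) z of (x, y) \<Rightarrow> \<beta> x y)"
    using P.linear_independent_extend[OF indep,
        of "\<lambda>z. case the_inv_into (X \<times> Y) (\<lambda>(x, y). x \<otimes> y) z of (x, y) \<Rightarrow> \<beta> x y"] by blast
  have gl: "g (f + f') = g f + g f'" "g (fscale c f) = s c (g f)" for f f' c
    using linear_imp_linear_on[OF g(1), of UNIV] by (auto simp: linear_on_def)
  have gxy: "g (x \<otimes> y) = \<beta> x y" if "x \<in> X" "y \<in> Y" for x y
    using g(2) that the_inv_into_f_f[OF inj, of "(x, y)"] by auto
  have gxw: "g (x \<otimes> w) = \<beta> x w" if "x \<in> X" "w \<in> W" for x w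
  proof (rule linear_on_span_eq[of s Y "\<lambda>w. g (x \<otimes> w)" "\<beta> x"])
    show "linear_on fscale s (fun_vs.span Y) (\<lambda>w. g (x \<otimes> w))"
      by (auto simp: linear_on_def tens_bilinear gl)
    show "linear_on fscale s (fun_vs.span Y) (\<beta> x)"
      using \<beta>2 that X sY by auto
  qed (use s gxy that sY in auto)
  have "g (v \<otimes> w) = \<beta> v w" if "v \<in> V" "w \<in> W" for v w
  proof (rule linear_on_span_eq[of s X "\<lambda>v. g (v \<otimes> w)" "\<lambda>v. \<beta> v w"])
    show "linear_on fscale s (fun_vs.span X) (\<lambda>v. g (v \<otimes> w))"
      by (auto simp: linear_on_def tens_bilinear gl)
    show "linear_on fscale s (fun_vs.span X) (\<lambda>v. \<beta> v w)"
      using \<beta>1 that sX by auto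
  qed (use s gxw that sX in auto)
  then show ?thesis
    using linear_imp_linear_on[OF g(1)] by (intro exI[of _ g]) auto
qed

lemma tensor_map:
  assumes "fun_vs.subspace V" "fun_vs.subspace W"
    and f: "linear_on fscale fscale V f" and g: "linear_on fscale fscale W g"
  shows "linear_on fscale fscale (V \<otimes>\<^sub>S W) (tensor_map V W f g)"
    and "v \<in> V \<Longrightarrow> w \<in> W \<Longrightarrow> tensor_map V W f g (v \<otimes> w) = f v \<otimes> g w"
proof -
  have "\<exists>h. linear_on fscale fscale (V \<otimes>\<^sub>S W) h \<and> (\<forall>v\<in>V. \<forall>w\<in>W. h (v \<otimes> w) = f v \<otimes> g w)"
    by (rule tensor_universal[OF assms(1,2) fun_vs.vector_space_axioms])
      (use f g in \<open>auto simp: linear_on_def tens_bilinear\<close>)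
  from someI_ex[OF this]
  show "linear_on fscale fscale (V \<otimes>\<^sub>S W) (tensor_map V W f g)"
    and "v \<in> V \<Longrightarrow> w \<in> W \<Longrightarrow> tensor_map V W f g (v \<otimes> w) = f v \<otimes> g w"
    unfolding tensor_map_def by blast+
qed

lemma reassoc_tens: "reassoc ((u \<otimes> v) \<otimes> (w \<otimes> z)) = u \<otimes> ((v \<otimes> w) \<otimes> z)"
  and unreassoc_tens: "unreassoc (u \<otimes> ((v \<otimes> w) \<otimes> z)) = (u \<otimes> v) \<otimes> (w \<otimes> z)"
  by (auto simp: reassoc_def unreassoc_def tens_def fun_eq_iff)

lemma concat_mult_word:
  fixes s :: "'k::field \<Rightarrow> 'v::ab_group_add \<Rightarrow> 'v"
  shows
  "concat_mult (word s vs \<otimes> word s ws) = word s (vs @ ws)"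
proof
  fix ps :: "('v \<Rightarrow> 'k) list"
  let ?n = "length vs"
  let ?t = "\<lambda>i. word s vs (take i ps) * word s ws (drop i ps)"
  have z: "?t i = 0" if "i \<le> length ps" "i \<noteq> ?n" for i
    using that by (auto simp: word_def)
  have lhs: "concat_mult (word s vs \<otimes> word s ws) ps = (\<Sum>i\<le>length ps. ?t i)"
    by (simp add: concat_mult_def tens_def)
  show "concat_mult (word s vs \<otimes> word s ws) ps = word s (vs @ ws) ps"
  proof (cases "?n \<le> length ps")
    case False
    then show ?thesis unfolding lhs
      by (subst sum.neutral) (use z in \<open>auto simp: word_def\<close>)
  next
    case True
    have "(\<Sum>i\<le>length ps. ?t i) = (\<Sum>i\<in>{?n}. ?t i)"
      by (rule sum.mono_neutral_right) (use True z in auto)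
    also have "\<dots> = word s (vs @ ws) ps"
    proof -
      define qs rs where "qs = take ?n ps" and "rs = drop ?n ps"
      have "ps = qs @ rs" "length qs = ?n" using True by (auto simp: qs_def rs_def)
      then show ?thesis by (auto simp: word_def)
    qed
    finally show ?thesis unfolding lhs .
  qed
qed

lemma word_multilinear:
  "word s (vs @ (x + y) # ws) = word s (vs @ x # ws) + word s (vs @ y # ws)" (is ?A)
  "word s (vs @ s c x # ws) = fscale c (word s (vs @ x # ws))" (is ?B)
proof -
  have split: "word s (vs @ v # ws) ps =
      (if length ps = length vs + Suc (length ws) \<and> (\<forall>\<phi>\<in>set ps. Vector_Spaces.linear s (*) \<phi>)
       then prod_list (map2 (\<lambda>\<phi> v. \<phi> v) (take (length vs) ps) vs) * ((ps ! length vs) v *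
         prod_list (map2 (\<lambda>\<phi> v. \<phi> v) (drop (Suc (length vs)) ps) ws)) else 0)" for v ps
  proof (cases "length ps = length vs + Suc (length ws)")
    case True
    then have "ps = take (length vs) ps @ ps ! length vs # drop (Suc (length vs)) ps"
      by (simp add: id_take_nth_drop)
    then obtain as \<phi> bs where ps: "ps = as @ \<phi> # bs" "length vs = length as"
      using True by (metis length_take min.absorb2 le_add1 min.commute)
    have "prod_list (map2 (\<lambda>\<phi> v. \<phi> v) (as @ \<phi> # bs) (vs @ v # ws)) =
        prod_list (map2 (\<lambda>\<phi> v. \<phi> v) as vs) * (\<phi> v * prod_list (map2 (\<lambda>\<phi> v. \<phi> v) bs ws))"
      using ps(2) by simp
    then show ?thesis using True ps by (simp add: word_def)
  qed (auto simp: word_def)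
  have lin: "\<phi> (x + y) = \<phi> x + \<phi> y" "\<phi> (s c x) = c * \<phi> x" if "Vector_Spaces.linear s (*) \<phi>" for \<phi>
    using linear_imp_linear_on[OF that, of UNIV] by (auto simp: linear_on_def)
  show ?A
    by (rule ext) (auto simp: split lin algebra_simps)
  show ?B
    by (rule ext) (auto simp: split lin fscale_def algebra_simps)
qed

lemma carrier_tensor_algebra: "carrier (tensor_algebra s) = fun_vs.span (range (word s))"
proof (rule antisym)
  show "carrier (tensor_algebra s) \<subseteq> fun_vs.span (range (word s))"
    unfolding carrier_def tensor_algebra_def
    by (rule fun_vs.span_minimal) (auto intro: fun_vs.span_mono[THEN subsetD, rotated])
  show "fun_vs.span (range (word s)) \<subseteq> carrier (tensor_algebra s)"
    unfolding carrier_def tensor_algebra_def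
    by (rule fun_vs.span_mono) (auto intro: fun_vs.span_base)
qed

lemma concat_mult_linear:
  "concat_mult (h + k) = concat_mult h + concat_mult k"
  "concat_mult (fscale c h) = fscale c (concat_mult h)"
  by (auto simp: concat_mult_def fscale_def fun_eq_iff sum.distrib sum_distrib_left)

theorem tensor_algebra_universal:
  fixes s :: "'k::field \<Rightarrow> 'v::ab_group_add \<Rightarrow> 'v" and f :: "'v \<Rightarrow> 'r::ring_1"
  assumes s: "vector_space s" and r: "vector_space r"
    and r_mult: "\<And>c x y. r c (x * y) = r c x * y" "\<And>c x y. r c (x * y) = x * r c y"
    and f: "Vector_Spaces.linear s r f"
  defines "T \<equiv> tensor_algebra s"
  shows "\<exists>F. linear_on fscale r (carrier T) F \<and> F (unit T) = 1 \<and>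
    (\<forall>x\<in>carrier T. \<forall>y\<in>carrier T. F (mult T (x \<otimes> y)) = F x * F y) \<and>
    (\<forall>v. F (word s [v]) = f v)"
proof -
  interpret s: vector_space s by fact
  interpret r: vector_space r by fact
  obtain X where X: "\<not> s.dependent X" "s.span X = UNIV"
    using s.maximal_independent_subset[of UNIV] by (metis top.extremum_uniqueI)
  have ex: "\<forall>x\<in>X. \<exists>\<phi>. Vector_Spaces.linear s (*) \<phi> \<and> \<phi> x = 1 \<and> (\<forall>y\<in>X. y \<noteq> x \<longrightarrow> \<phi> y = 0)"
    using linear_formsI[OF s X(1)] by metis
  obtain D where D: "\<And>x. x \<in> X \<Longrightarrow> Vector_Spaces.linear s (*) (D x)"
      "\<And>x. x \<in> X \<Longrightarrow> D x x = 1" "\<And>x y. x \<in> X \<Longrightarrow> y \<in> X \<Longrightarrow> y \<noteq> x \<Longrightarrow> D x y = 0"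
    using bchoice[OF ex] by blast
  have one: "word s xs (map D xs) = 1" if "set xs \<subseteq> X" for xs
  proof -
    have "prod_list (map2 (\<lambda>\<phi> v. \<phi> v) (map D xs) xs) = 1"
      using that by (induction xs) (auto simp: D)
    then show ?thesis using that D by (auto simp: word_def)
  qed
  have zero: "word s ys (map D xs) = 0" if "set xs \<subseteq> X" "set ys \<subseteq> X" "xs \<noteq> ys" for xs ys
  proof -
    have "prod_list (map2 (\<lambda>\<phi> v. \<phi> v) (map D xs) ys) = 0" if "length xs = length ys"
      using that \<open>set xs \<subseteq> X\<close> \<open>set ys \<subseteq> X\<close> \<open>xs \<noteq> ys\<close> D(3)
      by (induction xs ys rule: list_induct2) auto
    then show ?thesis by (auto simp: word_def)
  qed
  have inj: "inj_on (word s) (lists X)"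
  proof (rule inj_onI)
    fix xs ys assume a: "xs \<in> lists X" "ys \<in> lists X" "word s xs = word s ys"
    then have "word s ys (map D xs) = 1" using one[of xs] by auto
    then show "xs = ys" using zero[of xs ys] a by fastforce
  qed
  have indep: "\<not> fun_vs.dependent (word s ` lists X)"
  proof (rule independentI_forms)
    fix a assume "a \<in> word s ` lists X"
    then obtain xs where xs: "set xs \<subseteq> X" "a = word s xs" by auto
    have "linear_on fscale (*) UNIV (\<lambda>h. h (map D xs))"
      by (auto simp: linear_on_def fscale_def)
    then show "\<exists>\<phi>. linear_on fscale (*) UNIV \<phi> \<and> \<phi> a \<noteq> 0 \<and>
        (\<forall>b\<in>word s ` lists X. b \<noteq> a \<longrightarrow> \<phi> b = 0)"
      using xs one[OF xs(1)] zero[OF xs(1)]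
      by (intro exI[of _ "\<lambda>h. h (map D xs)"]) (auto simp: in_lists_conv_set subset_iff)
  qed
  interpret P: vector_space_pair "fscale :: 'k \<Rightarrow> (('v \<Rightarrow> 'k) list \<Rightarrow> 'k) \<Rightarrow> _" r by unfold_locales
  obtain F where F: "Vector_Spaces.linear fscale r F"
    "\<forall>z\<in>word s ` lists X. F z = prod_list (map f (the_inv_into (lists X) (word s) z))"
    using P.linear_independent_extend[OF indep,
        of "\<lambda>z. prod_list (map f (the_inv_into (lists X) (word s) z))"] by blast
  have Fl: "F (g + g') = F g + F g'" "F (fscale c g) = r c (F g)" for g g' c
    using linear_imp_linear_on[OF F(1), of UNIV] by (auto simp: linear_on_def)
  have fl: "f (x + y) = f x + f y" "f (s c x) = r c (f x)" for x y c
    using linear_imp_linear_on[OF f, of UNIV] by (auto simp: linear_on_def)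
  have FX: "F (word s xs) = prod_list (map f xs)" if "set xs \<subseteq> X" for xs
    using F(2) that the_inv_into_f_f[OF inj, of xs] by (auto simp: in_lists_conv_set subset_iff)
  have Fword': "\<forall>ws. set ws \<subseteq> X \<longrightarrow> F (word s (vs @ ws)) = prod_list (map f (vs @ ws))" for vs
  proof (induction vs rule: rev_induct)
    case Nil
    then show ?case using FX by auto
  next
    case (snoc v vs)
    show ?case
    proof (intro allI impI)
      fix ws assume ws: "set ws \<subseteq> X"
      have "v \<in> s.span X" using X by auto
      then have "F (word s (vs @ v # ws)) = prod_list (map f (vs @ v # ws))"
      proof (induction rule: s.span_induct_alt)
        case base
        have "word s (vs @ 0 # ws) = word s (vs @ s 0 0 # ws)" by simp
        also have "\<dots> = fscale 0 (word s (vs @ 0 # ws))" by (rule word_multilinear(2))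
        finally have 1: "F (word s (vs @ 0 # ws)) = r 0 (F (word s (vs @ 0 # ws)))"
          by (metis Fl(2))
        have "f 0 = 0" using fl(2)[of 0 0] by simp
        then show ?case using 1 by simp
      next
        case (step c x y)
        have "F (word s (vs @ x # ws)) = prod_list (map f (vs @ x # ws))"
          using snoc.IH[rule_format, of "x # ws"] ws step by auto
        moreover have "r c (prod_list (map f vs) * (f x * prod_list (map f ws))) =
            prod_list (map f vs) * (r c (f x) * prod_list (map f ws))"
          by (metis r_mult)
        ultimately show ?case
          unfolding word_multilinear Fl using step
          by (simp add: fl distrib_left distrib_right mult.assoc)
      qed
      then show "F (word s ((vs @ [v]) @ ws)) = prod_list (map f ((vs @ [v]) @ ws))" by simp
    qed
  qed
  have Fword: "F (word s vs) = prod_list (map f vs)" for vs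
    using Fword'[of vs, rule_format, of "[]"] by simp
  have m1: "F (concat_mult (x \<otimes> word s ws)) = F x * F (word s ws)"
    if "x \<in> fun_vs.span (range (word s))" for x ws
  proof (rule linear_on_span_eq[OF _ _ r _ that,
        of "\<lambda>x. F (concat_mult (x \<otimes> word s ws))" "\<lambda>x. F x * F (word s ws)"])
    show "linear_on fscale r (fun_vs.span (range (word s))) (\<lambda>x. F (concat_mult (x \<otimes> word s ws)))"
      by (auto simp: linear_on_def tens_bilinear concat_mult_linear Fl)
    show "linear_on fscale r (fun_vs.span (range (word s))) (\<lambda>x. F x * F (word s ws))"
      by (auto simp: linear_on_def Fl r_mult(1) algebra_simps)
  qed (auto simp: concat_mult_word Fword)
  have m2: "F (concat_mult (x \<otimes> y)) = F x * F y"
    if x: "x \<in> fun_vs.span (range (word s))" and y: "y \<in> fun_vs.span (range (word s))" for x y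
  proof (rule linear_on_span_eq[OF _ _ r _ y,
        of "\<lambda>y. F (concat_mult (x \<otimes> y))" "\<lambda>y. F x * F y"])
    show "linear_on fscale r (fun_vs.span (range (word s))) (\<lambda>y. F (concat_mult (x \<otimes> y)))"
      by (auto simp: linear_on_def tens_bilinear concat_mult_linear Fl)
    show "linear_on fscale r (fun_vs.span (range (word s))) (\<lambda>y. F x * F y)"
      by (auto simp: linear_on_def Fl r_mult(2) algebra_simps)
  qed (use m1[OF x] in auto)
  show ?thesis
  proof (intro exI[of _ F] conjI)
    show "linear_on fscale r (carrier T) F" by (rule linear_imp_linear_on[OF F(1)])
    show "F (unit T) = 1" using Fword[of "[]"] by (simp add: T_def tensor_algebra_def)
    show "\<forall>x\<in>carrier T. \<forall>y\<in>carrier T. F (mult T (x \<otimes> y)) = F x * F y"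
      using m2 unfolding T_def carrier_tensor_algebra by (simp add: tensor_algebra_def)
    show "\<forall>v. F (word s [v]) = f v" using Fword by simp
  qed
qed

theorem tensor_algebra_unique:
  fixes s :: "'k::field \<Rightarrow> 'v::ab_group_add \<Rightarrow> 'v" and F G :: "_ \<Rightarrow> 'r::ring_1"
  defines "T \<equiv> tensor_algebra s"
  assumes r: "vector_space r"
    and F: "linear_on fscale r (carrier T) F" "F (unit T) = 1"
      "\<And>x y. x \<in> carrier T \<Longrightarrow> y \<in> carrier T \<Longrightarrow> F (mult T (x \<otimes> y)) = F x * F y"
    and G: "linear_on fscale r (carrier T) G" "G (unit T) = 1"
      "\<And>x y. x \<in> carrier T \<Longrightarrow> y \<in> carrier T \<Longrightarrow> G (mult T (x \<otimes> y)) = G x * G y"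
    and eq: "\<And>v. F (word s [v]) = G (word s [v])" and z: "z \<in> carrier T"
  shows "F z = G z"
proof -
  have w: "word s vs \<in> carrier T" for vs
    unfolding T_def carrier_tensor_algebra by (auto intro: fun_vs.span_base)
  have "F (word s vs) = G (word s vs)" for vs
  proof (induction vs)
    case Nil
    then show ?case using F(2) G(2) by (simp add: T_def tensor_algebra_def)
  next
    case (Cons v vs)
    have "word s (v # vs) = mult T (word s [v] \<otimes> word s vs)"
      using concat_mult_word[of s "[v]" vs] by (simp add: T_def tensor_algebra_def)
    then show ?case using F(3)[OF w w] G(3)[OF w w] eq Cons by simp
  qed
  then show ?thesis
    using linear_on_span_eq[of r "range (word s)" F G z] F(1) G(1) r z
    unfolding T_def carrier_tensor_algebra by auto
qed

end

theory Submission
  imports Defs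
begin

text \<open>
  Because \<open>B\<close> is free, a twisting map is the same as a family of right \<open>B\<close>-linear operators \<open>L y\<close> on
  \<open>A \<otimes> B\<close>, one for each basis vector \<open>y\<close> of \<open>B\<^sub>1\<close>, with \<open>L y (1 \<otimes> 1) = 1 \<otimes> y\<close> and
  \<open>L y (x \<cdot> h) = t (y \<otimes> x) \<cdot> h\<close>, where \<open>(a \<otimes> y\<^sub>1 \<dots> y\<^sub>k) \<cdot> h = a \<cdot> L y\<^sub>1 (\<dots> (L y\<^sub>k h))\<close>.
  The second equation defines \<open>L y\<close> by recursion on the \<open>A\<close>-degree. The only term of \<open>t (y \<otimes> x) \<cdot> h\<close>
  to which two operators are applied is \<open>L b (L d h)\<close> with \<open>d\<close> in the second part of the basis; since
  \<open>L d\<close> does not raise the \<open>A\<close>-degree, the recursion is well founded. The same induction shows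
  \<open>(L y c) \<cdot> h = L y (c \<cdot> h)\<close>, which is the twisting identity for
  \<open>\<tau> (y\<^sub>1 \<dots> y\<^sub>k \<otimes> a) = L y\<^sub>1 (\<dots> (L y\<^sub>k (a \<otimes> 1)))\<close>.
\<close>


section \<open>Linear maps between function spaces\<close>

abbreviation lin :: "(('x \<Rightarrow> 'k::field) \<Rightarrow> ('y \<Rightarrow> 'k)) \<Rightarrow> bool" where
  "lin \<equiv> Vector_Spaces.linear fscale fscale"

lemma vector_space_pair_fscale: "vector_space_pair fscale fscale"
  by (intro vector_space_pair.intro fun_vs.vector_space_axioms)

lemma lin_iff: "lin f \<longleftrightarrow> (\<forall>x y. f (x + y) = f x + f y) \<and> (\<forall>c x. f (fscale c x) = fscale c (f x))"
  unfolding linear_iff_module_hom module_hom_def module_hom_axioms_def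
  by (simp add: fun_vs.module_axioms)

lemma lin_comp: "lin f \<Longrightarrow> lin g \<Longrightarrow> lin (\<lambda>h. f (g h))"
  by (simp add: lin_iff)

lemma lin_id: "lin (\<lambda>h. h)"
  by (simp add: lin_iff)

lemma lin_foldr: "(\<And>y. lin (L y)) \<Longrightarrow> lin (foldr L ys)"
  by (induction ys) (auto simp: lin_iff)

lemma lin_span_eq:
  assumes "lin f" "lin g" "x \<in> fun_vs.span S" "\<And>b. b \<in> S \<Longrightarrow> f b = g b"
  shows "f x = g x"
  using vector_space_pair.linear_eq_on_span[OF vector_space_pair_fscale assms(1,2,4,3)] .

lemma linear_on_span_in:
  assumes "linear_on fscale fscale (fun_vs.span S) f" "fun_vs.subspace W" "x \<in> fun_vs.span S"
    and "\<And>b. b \<in> S \<Longrightarrow> f b \<in> W"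
  shows "f x \<in> W"
proof -
  have "x \<in> fun_vs.span S \<and> f x \<in> W" using assms(3)
  proof (induction rule: fun_vs.span_induct_alt)
    case base
    show ?case
      using linear_on_zero[OF assms(1) fun_vs.span_zero fun_vs.vector_space_axioms]
        fun_vs.subspace_0[OF assms(2)] fun_vs.span_zero by metis
  next
    case (step c x y)
    then have 1: "x \<in> fun_vs.span S" "fscale c x \<in> fun_vs.span S" "y \<in> fun_vs.span S"
      by (auto intro: fun_vs.span_base fun_vs.span_scale)
    then have "f (fscale c x + y) = fscale c (f x) + f y"
      using assms(1) by (auto simp: linear_on_def)
    then show ?case
      using 1 step assms(2,4) fun_vs.span_add fun_vs.subspace_add fun_vs.subspace_scale by metis
  qed
  then show ?thesis by simp
qed

lemma lin_span_in:
  assumes "lin f" "fun_vs.subspace W" "x \<in> fun_vs.span S" "\<And>b. b \<in> S \<Longrightarrow> f b \<in> W"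
  shows "f x \<in> W"
  using linear_on_span_in[OF linear_imp_linear_on[OF assms(1)] assms(2-4)] .

section \<open>Operators on a free bimodule\<close>

text \<open>
  \<open>E xs ys\<close> stands for the tensor \<open>x\<^sub>1 \<dots> x\<^sub>k \<otimes> y\<^sub>1 \<dots> y\<^sub>l\<close> of two basis words.
\<close>

locale free_bimodule =
  fixes E :: "'a list \<Rightarrow> 'b list \<Rightarrow> 'z \<Rightarrow> 'k::field" and X :: "'a set" and Y :: "'b set"
  assumes indep: "\<not> fun_vs.dependent ((\<lambda>(xs, ys). E xs ys) ` (lists X \<times> lists Y))"
    and inj: "inj_on (\<lambda>(xs, ys). E xs ys) (lists X \<times> lists Y)"
begin

text \<open>Linear extension of values prescribed on the basis. The choice pins down the map on the
  span of the basis only; elsewhere it need not depend linearly on \<open>g\<close>.\<close>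

definition ext :: "('a list \<Rightarrow> 'b list \<Rightarrow> 'w \<Rightarrow> 'k) \<Rightarrow> ('z \<Rightarrow> 'k) \<Rightarrow> 'w \<Rightarrow> 'k" where
  "ext g = (SOME f. lin f \<and> (\<forall>xs\<in>lists X. \<forall>ys\<in>lists Y. f (E xs ys) = g xs ys))"

lemma lin_ext: "lin (ext g)"
  and ext_E: "xs \<in> lists X \<Longrightarrow> ys \<in> lists Y \<Longrightarrow> ext g (E xs ys) = g xs ys"
proof -
  let ?e = "\<lambda>(xs, ys). E xs ys" and ?I = "lists X \<times> lists Y"
  \<comment> \<open>The extension theorem wants a function of the basis vector itself; injectivity
    of the indexing lets the two words be recovered from that vector.\<close>
  obtain f where f: "lin f" "\<forall>z\<in>?e ` ?I. f z = case_prod g (the_inv_into ?I ?e z)"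
    using vector_space_pair.linear_independent_extend[OF vector_space_pair_fscale indep,
        of "\<lambda>z. case_prod g (the_inv_into ?I ?e z)"] by blast
  have "f (E xs ys) = g xs ys" if "xs \<in> lists X" "ys \<in> lists Y" for xs ys
    using f(2) that the_inv_into_f_f[OF inj, of "(xs, ys)"] by auto
  with f(1) have "\<exists>f. lin f \<and> (\<forall>xs\<in>lists X. \<forall>ys\<in>lists Y. f (E xs ys) = g xs ys)" by blast
  from someI_ex[OF this] show "lin (ext g)"
    and "xs \<in> lists X \<Longrightarrow> ys \<in> lists Y \<Longrightarrow> ext g (E xs ys) = g xs ys"
    unfolding ext_def by blast+
qed

section \<open>The free bimodule, filtered by A-degree and graded by total degree\<close>

definition C :: "('z \<Rightarrow> 'k) set" where
  "C = fun_vs.span {E xs ys | xs ys. xs \<in> lists X \<and> ys \<in> lists Y}"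

text \<open>The bound \<open>n\<close> on the A-degree carries the inductions. The total degree
  \<open>m\<close> is exact, so that degree preservation of the twisting map comes out of the same
  estimates.\<close>

definition K :: "nat \<Rightarrow> nat \<Rightarrow> ('z \<Rightarrow> 'k) set" where
  "K n m = fun_vs.span {E xs ys | xs ys. xs \<in> lists X \<and> ys \<in> lists Y \<and>
     length xs \<le> n \<and> length xs + length ys = m}"

lemma subspace_C: "fun_vs.subspace C"
  and subspace_K: "fun_vs.subspace (K n m)"
  by (simp_all add: C_def K_def)

lemma E_C: "xs \<in> lists X \<Longrightarrow> ys \<in> lists Y \<Longrightarrow> E xs ys \<in> C"
  unfolding C_def by (rule fun_vs.span_base) blast

lemma E_K:
  "xs \<in> lists X \<Longrightarrow> ys \<in> lists Y \<Longrightarrow> length xs \<le> n \<Longrightarrow> length xs + length ys = m \<Longrightarrow> E xs ys \<in> K n m"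
  unfolding K_def by (rule fun_vs.span_base) blast

lemma K_mono: "n \<le> n' \<Longrightarrow> K n m \<subseteq> K n' m"
  unfolding K_def by (rule fun_vs.span_mono) force

lemma K_C: "K n m \<subseteq> C"
  unfolding K_def C_def by (rule fun_vs.span_mono) blast

lemma C_eqI:
  assumes "lin f" "lin g" "h \<in> C"
    and "\<And>xs ys. xs \<in> lists X \<Longrightarrow> ys \<in> lists Y \<Longrightarrow> f (E xs ys) = g (E xs ys)"
  shows "f h = g h"
  by (rule lin_span_eq[OF assms(1,2) assms(3)[unfolded C_def]]) (use assms(4) in blast)

lemma K_eqI:
  assumes "lin f" "lin g" "h \<in> K n m"
    and "\<And>xs ys. xs \<in> lists X \<Longrightarrow> ys \<in> lists Y \<Longrightarrow> length xs \<le> n \<Longrightarrow> length xs + length ys = m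
      \<Longrightarrow> f (E xs ys) = g (E xs ys)"
  shows "f h = g h"
  by (rule lin_span_eq[OF assms(1,2) assms(3)[unfolded K_def]]) (use assms(4) in blast)

lemma C_inI:
  assumes "lin f" "fun_vs.subspace W" "h \<in> C"
    and "\<And>xs ys. xs \<in> lists X \<Longrightarrow> ys \<in> lists Y \<Longrightarrow> f (E xs ys) \<in> W"
  shows "f h \<in> W"
  by (rule lin_span_in[OF assms(1,2) assms(3)[unfolded C_def]]) (use assms(4) in blast)

lemma K_inI:
  assumes "lin f" "fun_vs.subspace W" "h \<in> K n m"
    and "\<And>xs ys. xs \<in> lists X \<Longrightarrow> ys \<in> lists Y \<Longrightarrow> length xs \<le> n \<Longrightarrow> length xs + length ys = m
      \<Longrightarrow> f (E xs ys) \<in> W"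
  shows "f h \<in> W"
  by (rule lin_span_in[OF assms(1,2) assms(3)[unfolded K_def]]) (use assms(4) in blast)

section \<open>Multiplication by words of A on the left and by words of B on the right\<close>

definition lmul :: "'a list \<Rightarrow> ('z \<Rightarrow> 'k) \<Rightarrow> 'z \<Rightarrow> 'k" where
  "lmul xs = ext (\<lambda>xs' ys. E (xs @ xs') ys)"

definition rmul :: "'b list \<Rightarrow> ('z \<Rightarrow> 'k) \<Rightarrow> 'z \<Rightarrow> 'k" where
  "rmul ys = ext (\<lambda>xs ys'. E xs (ys' @ ys))"

lemma lin_lmul: "lin (lmul xs)" and lin_rmul: "lin (rmul ys)"
  by (simp_all add: lmul_def rmul_def lin_ext)

lemma lmul_E: "xs \<in> lists X \<Longrightarrow> ys \<in> lists Y \<Longrightarrow> lmul xs' (E xs ys) = E (xs' @ xs) ys"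
  and rmul_E: "xs \<in> lists X \<Longrightarrow> ys \<in> lists Y \<Longrightarrow> rmul ys' (E xs ys) = E xs (ys @ ys')"
  by (simp_all add: lmul_def rmul_def ext_E)

lemma lmul_C: "xs \<in> lists X \<Longrightarrow> h \<in> C \<Longrightarrow> lmul xs h \<in> C"
  by (rule C_inI[OF lin_lmul subspace_C]) (auto simp: lmul_E intro!: E_C)

lemma rmul_C: "ys \<in> lists Y \<Longrightarrow> h \<in> C \<Longrightarrow> rmul ys h \<in> C"
  by (rule C_inI[OF lin_rmul subspace_C]) (auto simp: rmul_E intro!: E_C)

lemma lmul_K: "xs \<in> lists X \<Longrightarrow> h \<in> K n m \<Longrightarrow> lmul xs h \<in> K (length xs + n) (length xs + m)"
  by (rule K_inI[OF lin_lmul subspace_K]) (auto simp: lmul_E intro!: E_K)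

lemma lmul_append:
  assumes "h \<in> C" "xs' \<in> lists X" shows "lmul (xs @ xs') h = lmul xs (lmul xs' h)"
  by (rule C_eqI[OF lin_lmul lin_comp[OF lin_lmul lin_lmul] assms(1)])
    (use assms in \<open>auto simp: lmul_E\<close>)

lemma lmul_Nil: "h \<in> C \<Longrightarrow> lmul [] h = h"
  by (rule C_eqI[OF lin_lmul lin_id]) (auto simp: lmul_E)

lemma lmul_rmul:
  assumes "h \<in> C" "xs \<in> lists X" "ys \<in> lists Y" shows "lmul xs (rmul ys h) = rmul ys (lmul xs h)"
  by (rule C_eqI[OF lin_comp[OF lin_lmul lin_rmul] lin_comp[OF lin_rmul lin_lmul] assms(1)])
    (use assms in \<open>auto simp: lmul_E rmul_E\<close>)

text \<open>
  The product \<open>c \<cdot> h\<close>, written \<open>act L h c\<close>.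
\<close>

definition act :: "('b \<Rightarrow> ('z \<Rightarrow> 'k) \<Rightarrow> 'z \<Rightarrow> 'k) \<Rightarrow> ('z \<Rightarrow> 'k) \<Rightarrow> ('z \<Rightarrow> 'k) \<Rightarrow> 'z \<Rightarrow> 'k" where
  "act L h = ext (\<lambda>xs ys. lmul xs (foldr L ys h))"

lemma lin_act: "lin (act L h)"
  by (simp add: act_def lin_ext)

lemma act_E: "xs \<in> lists X \<Longrightarrow> ys \<in> lists Y \<Longrightarrow> act L h (E xs ys) = lmul xs (foldr L ys h)"
  by (simp add: act_def ext_E)

text \<open>For a basis word \<open>c\<close> the map is a composite of linear maps. Both sides of
  each linearity law are linear in \<open>c\<close>, so the law spreads to the span
  \<open>C\<close>, where \<open>ext\<close> is determined.\<close>

lemma lin_act_left: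
  assumes "\<And>y. lin (L y)" "c \<in> C"
  shows "lin (\<lambda>h. act L h c)"
proof -
  have l: "lin (\<lambda>h. lmul xs (foldr L ys h))" for xs ys
    by (intro lin_comp[OF lin_lmul] lin_foldr assms(1))
  have "act L (h + h') c = act L h c + act L h' c" for h h'
    by (rule C_eqI[OF _ _ assms(2), of "act L (h + h')" "\<lambda>c. act L h c + act L h' c"])
      (use lin_act[of L] l in \<open>auto simp: lin_iff act_E fun_vs.scale_right_distrib\<close>)
  moreover have "act L (fscale r h) c = fscale r (act L h c)" for r h
    by (rule C_eqI[OF _ _ assms(2), of "act L (fscale r h)" "\<lambda>c. fscale r (act L h c)"])
      (use lin_act[of L] l in \<open>auto simp: lin_iff act_E fun_vs.scale_right_distrib mult.commute\<close>)
  ultimately show ?thesis by (simp add: lin_iff)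
qed

end

section \<open>Straightening data: \<open>T y x\<close> plays t(y \<otimes> x), \<open>U\<close> and
  \<open>D\<close> the two parts of the basis\<close>

locale straightening = free_bimodule E X Y
  for E :: "'a list \<Rightarrow> 'b list \<Rightarrow> 'z \<Rightarrow> 'k::field" and X :: "'a set" and Y :: "'b set" +
  fixes U D :: "'b set" and T :: "'b \<Rightarrow> 'a \<Rightarrow> 'z \<Rightarrow> 'k"
  assumes Y_eq: "Y = U \<union> D"
    and T_U: "\<And>u x. u \<in> U \<Longrightarrow> x \<in> X \<Longrightarrow>
      T u x \<in> fun_vs.span ({E [a] [v] | a v. a \<in> X \<and> v \<in> U} \<union> {E [a, a'] [] | a a'. a \<in> X \<and> a' \<in> X})"
    and T_D: "\<And>d x. d \<in> D \<Longrightarrow> x \<in> X \<Longrightarrow>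
      T d x \<in> fun_vs.span ({E [a] [v] | a v. a \<in> X \<and> v \<in> D} \<union> {E [] [y, v] | y v. y \<in> Y \<and> v \<in> D})"
begin

lemma D_Y: "d \<in> D \<Longrightarrow> d \<in> Y"
  by (simp add: Y_eq)

text \<open>A common shape for both cases. What it retains from the second one is that the inner
  letter of a term with two letters of B lies in \<open>D\<close>.\<close>

lemma T_span:
  assumes "y \<in> Y" "x \<in> X"
  shows "T y x \<in> fun_vs.span ({E [a] [v] | a v. a \<in> X \<and> v \<in> Y} \<union> {E [a, a'] [] | a a'. a \<in> X \<and> a' \<in> X}
    \<union> {E [] [y, v] | y v. y \<in> Y \<and> v \<in> D})" (is "_ \<in> ?S")
proof (cases "y \<in> U")
  case True
  show ?thesis
    by (rule subsetD[OF fun_vs.span_mono T_U[OF True assms(2)]]) (auto simp: Y_eq)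
next
  case False
  then have y: "y \<in> D" using assms Y_eq by blast
  show ?thesis
    by (rule subsetD[OF fun_vs.span_mono T_D[OF y assms(2)]]) (auto simp: Y_eq)
qed

lemma T_eqI:
  assumes "y \<in> Y" "x \<in> X" "lin f" "lin g"
    and "\<And>a v. a \<in> X \<Longrightarrow> v \<in> Y \<Longrightarrow> f (E [a] [v]) = g (E [a] [v])"
    and "\<And>a a'. a \<in> X \<Longrightarrow> a' \<in> X \<Longrightarrow> f (E [a, a'] []) = g (E [a, a'] [])"
    and "\<And>v d. v \<in> Y \<Longrightarrow> d \<in> D \<Longrightarrow> f (E [] [v, d]) = g (E [] [v, d])"
  shows "f (T y x) = g (T y x)"
  by (rule lin_span_eq[OF assms(3,4) T_span[OF assms(1,2)]]) (use assms(5-7) in blast)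

lemma T_inI:
  assumes "y \<in> Y" "x \<in> X" "lin f" "fun_vs.subspace W"
    and "\<And>a v. a \<in> X \<Longrightarrow> v \<in> Y \<Longrightarrow> f (E [a] [v]) \<in> W"
    and "\<And>a a'. a \<in> X \<Longrightarrow> a' \<in> X \<Longrightarrow> f (E [a, a'] []) \<in> W"
    and "\<And>v d. v \<in> Y \<Longrightarrow> d \<in> D \<Longrightarrow> f (E [] [v, d]) \<in> W"
  shows "f (T y x) \<in> W"
  by (rule lin_span_in[OF assms(3,4) T_span[OF assms(1,2)]]) (use assms(5-7) in blast)

lemma T_D_inI:
  assumes "y \<in> D" "x \<in> X" "lin f" "fun_vs.subspace W"
    and "\<And>a v. a \<in> X \<Longrightarrow> v \<in> D \<Longrightarrow> f (E [a] [v]) \<in> W"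
    and "\<And>v d. v \<in> Y \<Longrightarrow> d \<in> D \<Longrightarrow> f (E [] [v, d]) \<in> W"
  shows "f (T y x) \<in> W"
  by (rule lin_span_in[OF assms(3,4) T_D[OF assms(1,2)]]) (use assms(5-6) in blast)

lemma T_C: "y \<in> Y \<Longrightarrow> x \<in> X \<Longrightarrow> T y x \<in> C"
  by (rule T_inI[OF _ _ lin_id subspace_C]) (auto intro!: E_C intro: D_Y)

text \<open>
  \<open>trunc n\<close> agrees with the operators \<open>L\<close> in \<open>A\<close>-degree at most \<open>n\<close>; its values in higher
  \<open>A\<close>-degree are irrelevant.
\<close>

primrec trunc :: "nat \<Rightarrow> 'b \<Rightarrow> ('z \<Rightarrow> 'k) \<Rightarrow> 'z \<Rightarrow> 'k" where
  "trunc 0 y = ext (\<lambda>xs ys. if xs = [] then E [] (y # ys) else 0)"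
| "trunc (Suc n) y = ext (\<lambda>xs ys. if length xs \<le> n then trunc n y (E xs ys)
     else act (trunc n) (E (tl xs) ys) (T y (hd xs)))"

text \<open>A word is treated at the level equal to its own A-length, the first level at which
  \<open>trunc\<close> is meaningful on it.\<close>

definition L :: "'b \<Rightarrow> ('z \<Rightarrow> 'k) \<Rightarrow> 'z \<Rightarrow> 'k" where
  "L y = ext (\<lambda>xs ys. trunc (length xs) y (E xs ys))"

lemma lin_trunc: "lin (trunc n y)"
  by (cases n) (simp_all add: lin_ext)

lemma lin_L: "lin (L y)"
  by (simp add: L_def lin_ext)

lemma trunc_E:
  "length xs \<le> n \<Longrightarrow> xs \<in> lists X \<Longrightarrow> ys \<in> lists Y \<Longrightarrow> trunc n y (E xs ys) = L y (E xs ys)"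
proof (induction n)
  case (Suc n)
  then show ?case
    by (cases "length xs = Suc n") (auto simp: ext_E L_def)
qed (simp add: L_def ext_E)

lemma trunc_K: "h \<in> K n m \<Longrightarrow> trunc n y h = L y h"
  by (rule K_eqI[OF lin_trunc lin_L]) (assumption, rule trunc_E)

lemma L_Nil: "ys \<in> lists Y \<Longrightarrow> L y (E [] ys) = E [] (y # ys)"
  by (simp add: L_def ext_E)

text \<open>Unfolding gives this equation with \<open>trunc\<close> instead of \<open>L\<close> on
  the right. The two agree as long as \<open>L d\<close> keeps the A-degree within the level; this
  is a premise here because its proof is an induction that uses the equation itself.\<close>

lemma L_Cons_aux:
  assumes "\<And>d m h. d \<in> D \<Longrightarrow> h \<in> K (length xs) m \<Longrightarrow> L d h \<in> K (length xs) (Suc m)"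
    and xs: "x \<in> X" "xs \<in> lists X" "ys \<in> lists Y" and y: "y \<in> Y"
  shows "L y (E (x # xs) ys) = act L (E xs ys) (T y x)"
proof -
  let ?n = "length xs"
  have "L y (E (x # xs) ys) = act (trunc ?n) (E xs ys) (T y x)"
    using xs by (simp add: L_def ext_E)
  also have "\<dots> = act L (E xs ys) (T y x)"
  proof (rule T_eqI[OF y xs(1) lin_act lin_act])
    fix v d assume v: "v \<in> Y" "d \<in> D"
    \<comment> \<open>The outer operator meets a tensor that is no longer a basis word, but its
      A-degree is still at most \<open>?n\<close>, so truncation is harmless.\<close>
    have "trunc ?n v (L d (E xs ys)) = L v (L d (E xs ys))"
      by (rule trunc_K[OF assms(1)[OF v(2) E_K]]) (use xs in auto)
    then show "act (trunc ?n) (E xs ys) (E [] [v, d]) = act L (E xs ys) (E [] [v, d])"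
      using v xs by (simp add: act_E D_Y trunc_E)
  qed (use xs in \<open>auto simp: act_E trunc_E\<close>)
  finally show ?thesis .
qed

text \<open>The two bounds need each other. In \<open>L v (L d h)\<close> the inner operator keeps
  the A-degree and the outer one raises it by at most one; and the \<open>D\<close> half at level
  \<open>n\<close> is the premise that makes the recursion equation available for words of A-length
  \<open>Suc n\<close>.\<close>

lemma L_K_aux:
  "(\<forall>y\<in>Y. \<forall>m. \<forall>h\<in>K n m. L y h \<in> K (Suc n) (Suc m)) \<and> (\<forall>d\<in>D. \<forall>m. \<forall>h\<in>K n m. L d h \<in> K n (Suc m))"
proof (induction n)
  case 0
  \<comment> \<open>Without a letter of A an operator only prepends a letter of B, so one estimate
    serves both halves.\<close>
  have "L y h \<in> K 0 (Suc m)" if "y \<in> Y" "h \<in> K 0 m" for y m h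
    by (rule K_inI[OF lin_L subspace_K that(2)]) (use that in \<open>auto simp: L_Nil intro!: E_K\<close>)
  then show ?case using K_mono[of 0 "Suc 0"] D_Y by blast
next
  case (Suc n)
  have Y: "L y h \<in> K (Suc n) (Suc m)" if "y \<in> Y" "h \<in> K n m" for y h m using Suc that by blast
  have D: "L d h \<in> K n (Suc m)" if "d \<in> D" "h \<in> K n m" for d h m using Suc that by blast
  have Cons: "\<exists>x xs'. xs = x # xs' \<and> x \<in> X \<and> xs' \<in> lists X \<and> length xs' = n \<and> E xs' ys \<in> K n (n + length ys)
      \<and> L y (E xs ys) = act L (E xs' ys) (T y x)"
    if "y \<in> Y" "xs \<in> lists X" "ys \<in> lists Y" "length xs = Suc n" for y xs ys
    using that L_Cons_aux[of "tl xs" "hd xs" ys y] D by (cases xs) (auto intro: E_K)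
  have "L d h \<in> K (Suc n) (Suc m)" if d: "d \<in> D" and h: "h \<in> K (Suc n) m" for d h m
  proof (rule K_inI[OF lin_L subspace_K h])
    fix xs ys assume a: "xs \<in> lists X" "ys \<in> lists Y" "length xs \<le> Suc n" "length xs + length ys = m"
    show "L d (E xs ys) \<in> K (Suc n) (Suc m)"
    proof (cases "length xs = Suc n")
      case False
      then show ?thesis using a d D E_K[of xs ys n m] K_mono[of n "Suc n" "Suc m"] by auto
    next
      case True
      then obtain x xs' where x: "xs = x # xs'" "x \<in> X" "xs' \<in> lists X" "E xs' ys \<in> K n (n + length ys)"
        "L d (E xs ys) = act L (E xs' ys) (T d x)" using Cons[of d xs ys] a d by (auto simp: D_Y)
      \<comment> \<open>Each kind of term in \<open>T d x\<close> raises the degree at most once: by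
        the letter \<open>a'\<close> in front of \<open>L v\<close> with \<open>v\<close> in
        \<open>D\<close>, or by the outer operator applied to \<open>L d\<close>.\<close>
      have "act L (E xs' ys) (T d x) \<in> K (Suc n) (Suc m)"
      proof (rule T_D_inI[OF d x(2) lin_act subspace_K])
        fix a' v assume "a' \<in> X" "v \<in> D"
        then show "act L (E xs' ys) (E [a'] [v]) \<in> K (Suc n) (Suc m)"
          using lmul_K[OF _ D[OF _ x(4)], of "[a']" v] a True by (simp add: act_E D_Y)
      next
        fix v d assume v: "v \<in> Y" "d \<in> D"
        have d: "L d (E xs' ys) \<in> K n (Suc (n + length ys))" using D[OF v(2) x(4)] .
        have "L v (L d (E xs' ys)) \<in> K (Suc n) (Suc m)"
          using Y[OF v(1) d] a True by simp
        then show "act L (E xs' ys) (E [] [v, d]) \<in> K (Suc n) (Suc m)"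
          using v K_C by (auto simp: act_E D_Y lmul_Nil subset_iff)
      qed
      then show ?thesis using x by simp
    qed
  qed
  moreover have "L y h \<in> K (Suc (Suc n)) (Suc m)" if y: "y \<in> Y" and h: "h \<in> K (Suc n) m" for y h m
  proof (rule K_inI[OF lin_L subspace_K h])
    fix xs ys assume a: "xs \<in> lists X" "ys \<in> lists Y" "length xs \<le> Suc n" "length xs + length ys = m"
    show "L y (E xs ys) \<in> K (Suc (Suc n)) (Suc m)"
    proof (cases "length xs = Suc n")
      case False
      then show ?thesis using a y Y E_K[of xs ys n m] K_mono[of "Suc n" "Suc (Suc n)" "Suc m"] by auto
    next
      case True
      then obtain x xs' where x: "xs = x # xs'" "x \<in> X" "xs' \<in> lists X" "E xs' ys \<in> K n (n + length ys)"
        "L y (E xs ys) = act L (E xs' ys) (T y x)" using Cons[of y xs ys] a y by auto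
      \<comment> \<open>For general \<open>y\<close> the degree may rise twice, by \<open>a'\<close>
        and by \<open>L v\<close>, or by two letters \<open>a'\<close> and
        \<open>a''\<close>.\<close>
      have "act L (E xs' ys) (T y x) \<in> K (Suc (Suc n)) (Suc m)"
      proof (rule T_inI[OF y x(2) lin_act subspace_K])
        fix a' v assume "a' \<in> X" "v \<in> Y"
        then show "act L (E xs' ys) (E [a'] [v]) \<in> K (Suc (Suc n)) (Suc m)"
          using lmul_K[OF _ Y[OF _ x(4)], of "[a']" v] a True by (simp add: act_E D_Y)
      next
        fix a' a'' assume "a' \<in> X" "a'' \<in> X"
        then show "act L (E xs' ys) (E [a', a''] []) \<in> K (Suc (Suc n)) (Suc m)"
          using lmul_K[OF _ x(4), of "[a', a'']"] a True by (simp add: act_E)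
      next
        fix v d assume v: "v \<in> Y" "d \<in> D"
        have d: "L d (E xs' ys) \<in> K n (Suc (n + length ys))" using D[OF v(2) x(4)] .
        have "L v (L d (E xs' ys)) \<in> K (Suc n) (Suc m)"
          using Y[OF v(1) d] a True by simp
        then show "act L (E xs' ys) (E [] [v, d]) \<in> K (Suc (Suc n)) (Suc m)"
          using v K_C K_mono[of "Suc n" "Suc (Suc n)" "Suc m"] by (auto simp: act_E D_Y lmul_Nil subset_iff)
      qed
      then show ?thesis using x by simp
    qed
  qed
  ultimately show ?case by blast
qed

lemma L_K: "y \<in> Y \<Longrightarrow> h \<in> K n m \<Longrightarrow> L y h \<in> K (Suc n) (Suc m)"
  and L_K_D: "d \<in> D \<Longrightarrow> h \<in> K n m \<Longrightarrow> L d h \<in> K n (Suc m)"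
  using L_K_aux by blast+

lemma L_C: "y \<in> Y \<Longrightarrow> h \<in> C \<Longrightarrow> L y h \<in> C"
  by (rule C_inI[OF lin_L subspace_C]) (use L_K E_K K_C in blast)+

lemma foldr_L_C: "ys \<in> lists Y \<Longrightarrow> h \<in> C \<Longrightarrow> foldr L ys h \<in> C"
  by (induction ys) (auto simp: L_C)

lemma L_Cons_E:
  "x \<in> X \<Longrightarrow> xs \<in> lists X \<Longrightarrow> ys \<in> lists Y \<Longrightarrow> y \<in> Y \<Longrightarrow> L y (E (x # xs) ys) = act L (E xs ys) (T y x)"
  by (rule L_Cons_aux) (auto simp: L_K_D)

text \<open>The recursion equation with a general element in place of the remaining word;
  associativity folds its result back with it.\<close>

lemma L_lmul:
  assumes "x \<in> X" "y \<in> Y" "h \<in> C"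
  shows "L y (lmul [x] h) = act L h (T y x)"
  by (rule C_eqI[OF lin_comp[OF lin_L lin_lmul] lin_act_left[OF lin_L T_C] assms(3)])
    (use assms in \<open>auto simp: lmul_E L_Cons_E\<close>)

section \<open>Associativity: the operators \<open>L\<close> commute with the action\<close>

lemma act_C:
  assumes "h \<in> C" "c \<in> C" shows "act L h c \<in> C"
  by (rule C_inI[OF lin_act subspace_C assms(2)]) (use assms in \<open>auto simp: act_E intro!: lmul_C foldr_L_C\<close>)

lemma act_lmul:
  assumes "h \<in> C" "c \<in> C" "xs \<in> lists X" shows "act L h (lmul xs c) = lmul xs (act L h c)"
  by (rule C_eqI[OF lin_comp[OF lin_act lin_lmul] lin_comp[OF lin_lmul lin_act] assms(2)])
    (use assms in \<open>auto simp: act_E lmul_E lmul_append foldr_L_C\<close>)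

text \<open>Splitting off the first letter \<open>x\<close> of a word x w turns the claim into (t w)
  h = t (w h) with t = \<open>T y x\<close>, which is checked on the three kinds of terms of
  \<open>T y x\<close>. The induction is over bounds on the A-degree rather than over words, because
  it is also applied to \<open>L d ?w\<close>.\<close>

lemma act_L_K:
  assumes h: "h \<in> C"
  shows "y \<in> Y \<Longrightarrow> c \<in> K n m \<Longrightarrow> act L h (L y c) = L y (act L h c)"
proof (induction n arbitrary: y m c rule: less_induct)
  case (less n)
  show ?case
  proof (rule K_eqI[OF lin_comp[OF lin_act lin_L] lin_comp[OF lin_L lin_act] less.prems(2)])
    fix xs ys assume a: "xs \<in> lists X" "ys \<in> lists Y" "length xs \<le> n" "length xs + length ys = m"
    show "act L h (L y (E xs ys)) = L y (act L h (E xs ys))"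
    proof (cases xs)
      case Nil
      then show ?thesis using a less.prems h
        by (simp add: L_Nil act_E lmul_Nil L_C foldr_L_C)
    next
      case (Cons x w)
      let ?w = "E w ys"
      have w: "x \<in> X" "w \<in> lists X" "length w < n" "?w \<in> C" "?w \<in> K (length w) (length w + length ys)"
        using a Cons by (auto intro: E_K E_C)
      note IH = less.IH[OF w(3)]
      have "act L h (L y (E xs ys)) = act L h (act L ?w (T y x))"
        using Cons a w less.prems by (simp add: L_Cons_E)
      also have "\<dots> = act L (act L h ?w) (T y x)"
      proof (rule T_eqI[OF less.prems(1) w(1) lin_comp[OF lin_act lin_act] lin_act])
        fix a v assume "a \<in> X" "v \<in> Y"
        then show "act L h (act L ?w (E [a] [v])) = act L (act L h ?w) (E [a] [v])"
          using IH[OF _ w(5)] w h by (simp add: act_E[of "[a]"] act_lmul L_C)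
      next
        fix a a' assume "a \<in> X" "a' \<in> X"
        then show "act L h (act L ?w (E [a, a'] [])) = act L (act L h ?w) (E [a, a'] [])"
          using w h by (simp add: act_E[of "[a, a']"] act_lmul)
      next
        fix v d assume v: "v \<in> Y" "d \<in> D"
        have d: "d \<in> Y" using v D_Y by auto
        \<comment> \<open>The hypothesis is used twice: for \<open>v\<close> at
          \<open>L d ?w\<close>, whose A-degree is still at most \<open>length w\<close> because
          \<open>d\<close> lies in \<open>D\<close>, and then for \<open>d\<close> at
          \<open>?w\<close>.\<close>
        have "act L h (L v (L d ?w)) = L v (L d (act L h ?w))"
          using IH[OF v(1) L_K_D[OF v(2) w(5)]] IH[OF d w(5)] by simp
        then show "act L h (act L ?w (E [] [v, d])) = act L (act L h ?w) (E [] [v, d])"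
          using v d w h by (simp add: act_E[of "[]"] lmul_Nil L_C act_C)
      qed
      \<comment> \<open>The recursion equation is read backwards, now with \<open>act L h ?w\<close>
        in the place of the remaining word.\<close>
      also have "\<dots> = L y (lmul [x] (act L h ?w))"
        using w less.prems h by (simp add: L_lmul act_C)
      also have "\<dots> = L y (act L h (E xs ys))"
        using w h a Cons by (simp add: act_E lmul_append[of _ w "[x]", simplified] foldr_L_C)
      finally show ?thesis .
    qed
  qed
qed

lemma act_L:
  assumes h: "h \<in> C" "y \<in> Y" "c \<in> C"
  shows "act L h (L y c) = L y (act L h c)"
  by (rule C_eqI[OF lin_comp[OF lin_act lin_L] lin_comp[OF lin_L lin_act] assms(3)])
    (use act_L_K[OF assms(1,2)] E_K in blast)

lemma act_foldr_L:
  assumes "h \<in> C" "c \<in> C" "ys \<in> lists Y"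
  shows "act L h (foldr L ys c) = foldr L ys (act L h c)"
  using assms(3) by (induction ys) (use assms in \<open>auto simp: act_L foldr_L_C\<close>)

text \<open>The operators are right B-linear, by the same induction: appending \<open>zs\<close>
  changes only the word that remains after the first letter \<open>x\<close> is split off, and the
  term with two operators is again within reach because \<open>L d\<close> does not raise the
  A-degree.\<close>

lemma L_rmul_K:
  assumes zs: "zs \<in> lists Y"
  shows "y \<in> Y \<Longrightarrow> c \<in> K n m \<Longrightarrow> L y (rmul zs c) = rmul zs (L y c)"
proof (induction n arbitrary: y m c rule: less_induct)
  case (less n)
  show ?case
  proof (rule K_eqI[OF lin_comp[OF lin_L lin_rmul] lin_comp[OF lin_rmul lin_L] less.prems(2)])
    fix xs ys assume a: "xs \<in> lists X" "ys \<in> lists Y" "length xs \<le> n" "length xs + length ys = m"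
    show "L y (rmul zs (E xs ys)) = rmul zs (L y (E xs ys))"
    proof (cases xs)
      case Nil
      then show ?thesis using a less.prems zs by (simp add: L_Nil rmul_E)
    next
      case (Cons x w)
      let ?w = "E w ys"
      have w: "x \<in> X" "w \<in> lists X" "length w < n" "?w \<in> C" "?w \<in> K (length w) (length w + length ys)"
        using a Cons by (auto intro: E_K E_C)
      note IH = less.IH[OF w(3)]
      have "L y (rmul zs (E xs ys)) = act L (rmul zs ?w) (T y x)"
        using Cons a w less.prems zs by (simp add: L_Cons_E rmul_E)
      also have "\<dots> = rmul zs (act L ?w (T y x))"
      proof (rule T_eqI[OF less.prems(1) w(1) lin_act lin_comp[OF lin_rmul lin_act]])
        fix a v assume "a \<in> X" "v \<in> Y"
        then show "act L (rmul zs ?w) (E [a] [v]) = rmul zs (act L ?w (E [a] [v]))"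
          using IH[OF _ w(5)] w zs by (simp add: act_E lmul_rmul L_C)
      next
        fix a a' assume "a \<in> X" "a' \<in> X"
        then show "act L (rmul zs ?w) (E [a, a'] []) = rmul zs (act L ?w (E [a, a'] []))"
          using w zs by (simp add: act_E lmul_rmul)
      next
        fix v d assume v: "v \<in> Y" "d \<in> D"
        have d: "d \<in> Y" using v D_Y by auto
        have "L v (L d (rmul zs ?w)) = rmul zs (L v (L d ?w))"
          using IH[OF v(1) L_K_D[OF v(2) w(5)]] IH[OF d w(5)] by simp
        then show "act L (rmul zs ?w) (E [] [v, d]) = rmul zs (act L ?w (E [] [v, d]))"
          using v d w zs by (simp add: act_E lmul_Nil L_C rmul_C)
      qed
      also have "\<dots> = rmul zs (L y (E xs ys))"
        using Cons a w less.prems by (simp add: L_Cons_E)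
      finally show ?thesis .
    qed
  qed
qed

lemma L_rmul:
  assumes "zs \<in> lists Y" "y \<in> Y" "c \<in> C"
  shows "L y (rmul zs c) = rmul zs (L y c)"
  by (rule C_eqI[OF lin_comp[OF lin_L lin_rmul] lin_comp[OF lin_rmul lin_L] assms(3)])
    (use L_rmul_K[OF assms(1,2)] E_K in blast)

lemma foldr_L_rmul:
  assumes "zs \<in> lists Y" "c \<in> C" "ys \<in> lists Y"
  shows "foldr L ys (rmul zs c) = rmul zs (foldr L ys c)"
  using assms(3) by (induction ys) (use assms in \<open>auto simp: L_rmul foldr_L_C\<close>)

section \<open>Values of the twisting map on pairs of basis words\<close>

definition twist :: "'b list \<Rightarrow> 'a list \<Rightarrow> 'z \<Rightarrow> 'k" where
  "twist ys xs = foldr L ys (E xs [])"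

lemma twist_Nil: "twist [] xs = E xs []"
  by (simp add: twist_def)

lemma twist_unit: "ys \<in> lists Y \<Longrightarrow> twist ys [] = E [] ys"
  by (induction ys) (auto simp: twist_def L_Nil)

lemma twist_single:
  assumes "y \<in> Y" "x \<in> X" shows "twist [y] [x] = T y x"
proof -
  have "twist [y] [x] = act L (E [] []) (T y x)"
    using assms by (simp add: twist_def L_Cons_E)
  \<comment> \<open>The tensor \<open>E [] []\<close> is a right unit for the action, as is seen on
    each kind of term of \<open>T y x\<close>.\<close>
  also have "\<dots> = T y x"
    by (rule T_eqI[OF assms lin_act lin_id]) (auto simp: act_E L_Nil lmul_E D_Y)
  finally show ?thesis .
qed

lemma foldr_L_K:
  assumes "h \<in> K n m" "ys \<in> lists Y" shows "foldr L ys h \<in> K (length ys + n) (length ys + m)"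
  using assms(2) by (induction ys) (use assms(1) in \<open>auto intro: L_K\<close>)

text \<open>The bound on the A-degree is crude on purpose: with equal indices \<open>K\<close>
  contains every basis tensor of that total degree, so the statement says that the map is
  graded.\<close>

lemma twist_K: "xs \<in> lists X \<Longrightarrow> ys \<in> lists Y \<Longrightarrow> twist ys xs \<in> K (length ys + length xs) (length ys + length xs)"
  unfolding twist_def by (intro foldr_L_K E_K) auto

lemma twist_C: "xs \<in> lists X \<Longrightarrow> ys \<in> lists Y \<Longrightarrow> twist ys xs \<in> C"
  using twist_K K_C by blast

text \<open>By right linearity the action is the twisted product on A \<otimes> B: the inner words
  are exchanged by \<open>twist\<close>, the outer ones multiply from the two sides.\<close>

lemma act_E_E:
  assumes "xs \<in> lists X" "ys \<in> lists Y" "xs' \<in> lists X" "ys' \<in> lists Y"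
  shows "act L (E xs' ys') (E xs ys) = lmul xs (rmul ys' (twist ys xs'))"
  using assms rmul_E[of xs' "[]" ys'] by (simp add: act_E twist_def flip: foldr_L_rmul[OF _ E_C])

text \<open>The multiplicative law of a twisting map on basis words. Here \<open>ext\<close> runs
  through the terms \<open>E x g\<close> of \<open>twist ys' xs\<close>, the result of the first
  exchange, and \<open>act\<close> is the twisted product of the two exchanges that follow.\<close>

lemma twist_append:
  assumes "xs \<in> lists X" "xs' \<in> lists X" "ys \<in> lists Y" "ys' \<in> lists Y"
  shows "twist (ys @ ys') (xs @ xs') = ext (\<lambda>x g. act L (twist g xs') (twist ys x)) (twist ys' xs)"
proof -
  have E: "E xs' [] \<in> C" "E xs [] \<in> C" using assms by (auto intro: E_C)
  \<comment> \<open>Writing the A-word as a product lets associativity move the action of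
    \<open>ys'\<close> onto the factor \<open>xs\<close> alone.\<close>
  have "foldr L ys' (E (xs @ xs') []) = foldr L ys' (act L (E xs' []) (E xs []))"
    using assms by (simp add: act_E lmul_E)
  also have "\<dots> = act L (E xs' []) (twist ys' xs)"
    using assms E by (simp add: act_foldr_L twist_def)
  finally have 1: "twist (ys @ ys') (xs @ xs') = foldr L ys (act L (E xs' []) (twist ys' xs))"
    by (simp add: twist_def)
  \<comment> \<open>For one term, \<open>g\<close> is first absorbed into
    \<open>twist g xs'\<close>; then associativity moves \<open>ys\<close> onto
    \<open>x\<close>.\<close>
  have "foldr L ys (act L (E xs' []) (E x g)) = act L (twist g xs') (twist ys x)"
    if "x \<in> lists X" "g \<in> lists Y" for x g
  proof -
    have "act L (E xs' []) (E x g) = act L (twist g xs') (E x [])"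
      using that by (simp add: act_E twist_def)
    then show ?thesis
      using that assms act_foldr_L[OF twist_C E_C, of xs' g x "[]" ys] by (simp add: twist_def)
  qed
  then show ?thesis unfolding 1
    by (intro C_eqI[OF lin_comp[OF lin_foldr[OF lin_L] lin_act] lin_ext twist_C])
      (use assms in \<open>auto simp: ext_E\<close>)
qed

end


section \<open>Maps on tensor products\<close>

lemma linear_on_comp:
  assumes "linear_on s1 s2 S f" "\<And>x. x \<in> S \<Longrightarrow> f x \<in> S'" "linear_on s2 s3 S' g"
  shows "linear_on s1 s3 S (g \<circ> f)"
  using assms unfolding linear_on_def by simp

lemma linear_on_id: "linear_on s s S id"
  by (simp add: linear_on_def)

lemma subspace_tensor_space: "fun_vs.subspace (V \<otimes>\<^sub>S W)"
  by (simp add: tensor_space_def)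

lemma tensor_space_inI:
  assumes "linear_on fscale fscale (V \<otimes>\<^sub>S W) f" "fun_vs.subspace R" "z \<in> V \<otimes>\<^sub>S W"
    and "\<And>v w. v \<in> V \<Longrightarrow> w \<in> W \<Longrightarrow> f (v \<otimes> w) \<in> R"
  shows "f z \<in> R"
  by (rule linear_on_span_in[OF assms(1)[unfolded tensor_space_def] assms(2)])
    (use assms(3,4) in \<open>auto simp: tensor_space_def\<close>)

lemma lin_tens_left: "lin (\<lambda>v. v \<otimes> w)" and lin_tens_right: "lin (\<lambda>w. v \<otimes> w)"
  by (auto simp: lin_iff tens_bilinear)

lemma linear_on_tens:
  assumes "linear_on fscale fscale (V \<otimes>\<^sub>S W) f"
  shows "w \<in> W \<Longrightarrow> linear_on fscale fscale V (\<lambda>v. f (v \<otimes> w))"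
    and "v \<in> V \<Longrightarrow> linear_on fscale fscale W (\<lambda>w. f (v \<otimes> w))"
  using assms by (auto simp: linear_on_def tens_bilinear tens_in_tensor_space)

lemma linear_on_tens3:
  assumes "linear_on fscale fscale (V \<otimes>\<^sub>S (Q \<otimes>\<^sub>S W)) f" "v \<in> V" "w \<in> W"
  shows "linear_on fscale fscale Q (\<lambda>q. f (v \<otimes> (q \<otimes> w)))"
  using linear_on_tens(1)[OF linear_on_tens(2)[OF assms(1,2)] assms(3)] .

lemma tensor_space_span:
  "fun_vs.span S \<otimes>\<^sub>S fun_vs.span S' = fun_vs.span {v \<otimes> w | v w. v \<in> S \<and> w \<in> S'}" (is "?L = fun_vs.span ?R")
proof (rule antisym)
  show "fun_vs.span ?R \<subseteq> ?L"
    unfolding tensor_space_def by (rule fun_vs.span_mono) (blast intro: fun_vs.span_base)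
  have "v \<otimes> w \<in> fun_vs.span ?R" if "v \<in> fun_vs.span S" "w \<in> fun_vs.span S'" for v w
  proof (rule lin_span_in[OF lin_tens_left fun_vs.subspace_span that(1)])
    fix v assume "v \<in> S"
    then show "v \<otimes> w \<in> fun_vs.span ?R"
      by (intro lin_span_in[OF lin_tens_right fun_vs.subspace_span that(2)]) (blast intro: fun_vs.span_base)
  qed
  then show "?L \<subseteq> fun_vs.span ?R"
    unfolding tensor_space_def[of "fun_vs.span S"] by (intro fun_vs.span_minimal) auto
qed

lemma tensor_map_in:
  assumes "fun_vs.subspace V" "fun_vs.subspace W"
    and "linear_on fscale fscale V f" "linear_on fscale fscale W g"
    and "\<And>v. v \<in> V \<Longrightarrow> f v \<in> V'" "\<And>w. w \<in> W \<Longrightarrow> g w \<in> W'" and "z \<in> V \<otimes>\<^sub>S W"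
  shows "tensor_map V W f g z \<in> V' \<otimes>\<^sub>S W'"
  by (rule tensor_space_inI[OF tensor_map(1)[OF assms(1-4)] subspace_tensor_space assms(7)])
    (use assms(5,6) in \<open>simp add: tensor_map(2)[OF assms(1-4)] tens_in_tensor_space\<close>)

lemma lin_reassoc: "lin reassoc" and lin_unreassoc: "lin unreassoc"
  by (auto simp: lin_iff reassoc_def unreassoc_def fscale_def fun_eq_iff)

text \<open>The two factors of a pure tensor are themselves sums of pure tensors, so each is reduced
  in turn by linearity.\<close>

lemma reassoc_in:
  assumes "z \<in> (V \<otimes>\<^sub>S W) \<otimes>\<^sub>S (V' \<otimes>\<^sub>S W')"
  shows "reassoc z \<in> V \<otimes>\<^sub>S ((W \<otimes>\<^sub>S V') \<otimes>\<^sub>S W')" (is "_ \<in> ?R")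
proof -
  note l = linear_imp_linear_on[OF lin_reassoc]
  note sub = subspace_tensor_space
  have "reassoc (p \<otimes> q) \<in> ?R" if p: "p \<in> V \<otimes>\<^sub>S W" and q: "q \<in> V' \<otimes>\<^sub>S W'" for p q
  proof (rule tensor_space_inI[of V W "\<lambda>p. reassoc (p \<otimes> q)", OF _ sub p])
    fix v w assume vw: "v \<in> V" "w \<in> W"
    show "reassoc ((v \<otimes> w) \<otimes> q) \<in> ?R"
      by (rule tensor_space_inI[of V' W' "\<lambda>q. reassoc ((v \<otimes> w) \<otimes> q)", OF _ sub q])
        (use vw lin_reassoc in \<open>auto simp: reassoc_tens linear_on_def lin_iff tens_bilinear
          intro!: tens_in_tensor_space\<close>)
  qed (use lin_reassoc in \<open>auto simp: linear_on_def lin_iff tens_bilinear\<close>)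
  then show ?thesis using tensor_space_inI[OF l sub assms] by blast
qed

lemma unreassoc_in:
  assumes "z \<in> V \<otimes>\<^sub>S ((W \<otimes>\<^sub>S V') \<otimes>\<^sub>S W')"
  shows "unreassoc z \<in> (V \<otimes>\<^sub>S W) \<otimes>\<^sub>S (V' \<otimes>\<^sub>S W')" (is "_ \<in> ?R")
proof -
  note l = linear_imp_linear_on[OF lin_unreassoc]
  note sub = subspace_tensor_space
  have "unreassoc (v \<otimes> p) \<in> ?R" if v: "v \<in> V" and p: "p \<in> (W \<otimes>\<^sub>S V') \<otimes>\<^sub>S W'" for v p
  proof (rule tensor_space_inI[of "W \<otimes>\<^sub>S V'" W' "\<lambda>p. unreassoc (v \<otimes> p)", OF _ sub p])
    fix q w' assume q: "q \<in> W \<otimes>\<^sub>S V'" and w': "w' \<in> W'"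
    show "unreassoc (v \<otimes> (q \<otimes> w')) \<in> ?R"
      by (rule tensor_space_inI[of W V' "\<lambda>q. unreassoc (v \<otimes> (q \<otimes> w'))", OF _ sub q])
        (use v w' lin_unreassoc in \<open>auto simp: unreassoc_tens linear_on_def lin_iff tens_bilinear
          intro!: tens_in_tensor_space\<close>)
  qed (use lin_unreassoc in \<open>auto simp: linear_on_def lin_iff tens_bilinear\<close>)
  then show ?thesis using tensor_space_inI[OF l sub assms] by blast
qed

section \<open>Bases of tensor algebras\<close>

lemma lin_concat_mult: "lin concat_mult"
  by (simp add: lin_iff concat_mult_linear)

text \<open>Words are functions on lists of forms, so evaluation at the list of coordinate forms
  belonging to \<open>xs\<close> reads off the coefficient of the word \<open>xs\<close>.\<close>

lemma word_dual:
  fixes s :: "'k::field \<Rightarrow> 'v::ab_group_add \<Rightarrow> 'v"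
  assumes "vector_space s" "\<not> module.dependent s X"
  obtains d where "\<And>xs ys. xs \<in> lists X \<Longrightarrow> ys \<in> lists X \<Longrightarrow> word s ys (map d xs) = (if xs = ys then 1 else 0)"
proof -
  have "\<forall>x\<in>X. \<exists>\<phi>. Vector_Spaces.linear s (*) \<phi> \<and> \<phi> x = 1 \<and> (\<forall>y\<in>X. y \<noteq> x \<longrightarrow> \<phi> y = 0)"
    using linear_formsI[OF assms] by metis
  then obtain d where d: "\<And>x. x \<in> X \<Longrightarrow> Vector_Spaces.linear s (*) (d x)"
      "\<And>x. x \<in> X \<Longrightarrow> d x x = 1" "\<And>x y. x \<in> X \<Longrightarrow> y \<in> X \<Longrightarrow> y \<noteq> x \<Longrightarrow> d x y = 0"
    by metis
  have "prod_list (map2 (\<lambda>\<phi> v. \<phi> v) (map d xs) ys) = (if xs = ys then 1 else 0)"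
    if "length xs = length ys" "xs \<in> lists X" "ys \<in> lists X" for xs ys
    using that by (induction xs ys rule: list_induct2) (auto simp: d)
  then have "word s ys (map d xs) = (if xs = ys then 1 else 0)" if "xs \<in> lists X" "ys \<in> lists X" for xs ys
    using that d(1) by (auto simp: word_def)
  then show thesis using that by blast
qed

lemma free_bimodule_words:
  fixes s :: "'k::field \<Rightarrow> 'v::ab_group_add \<Rightarrow> 'v" and s' :: "'k \<Rightarrow> 'w::ab_group_add \<Rightarrow> 'w"
  assumes "vector_space s" "\<not> module.dependent s X" "vector_space s'" "\<not> module.dependent s' Y"
  shows "free_bimodule (\<lambda>xs ys. word s xs \<otimes> word s' ys) X Y"
proof -
  obtain d where d: "\<And>xs ys. xs \<in> lists X \<Longrightarrow> ys \<in> lists X \<Longrightarrow> word s ys (map d xs) = (if xs = ys then 1 else 0)"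
    using word_dual[OF assms(1,2)] by blast
  obtain d' where d': "\<And>xs ys. xs \<in> lists Y \<Longrightarrow> ys \<in> lists Y \<Longrightarrow> word s' ys (map d' xs) = (if xs = ys then 1 else 0)"
    using word_dual[OF assms(3,4)] by blast
  \<comment> \<open>Evaluation at a pair of such lists is a dual functional; it yields both
    independence and injectivity.\<close>
  have dual: "(word s xs' \<otimes> word s' ys') (map d xs, map d' ys) = (if xs = xs' \<and> ys = ys' then 1 else 0)"
    if "xs \<in> lists X" "xs' \<in> lists X" "ys \<in> lists Y" "ys' \<in> lists Y" for xs xs' ys ys'
    using that by (simp add: tens_def d d')
  show ?thesis
  proof
    let ?S = "(\<lambda>(xs, ys). word s xs \<otimes> word s' ys) ` (lists X \<times> lists Y)"
    show "\<not> fun_vs.dependent ?S"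
    proof (rule independentI_forms)
      fix a assume "a \<in> ?S"
      then obtain xs ys where a: "xs \<in> lists X" "ys \<in> lists Y" "a = word s xs \<otimes> word s' ys" by auto
      have "linear_on fscale (*) UNIV (\<lambda>h. h (map d xs, map d' ys))"
        by (auto simp: linear_on_def fscale_def)
      then show "\<exists>\<phi>. linear_on fscale (*) UNIV \<phi> \<and> \<phi> a \<noteq> 0 \<and> (\<forall>b\<in>?S. b \<noteq> a \<longrightarrow> \<phi> b = 0)"
        using a dual by (intro exI[of _ "\<lambda>h. h (map d xs, map d' ys)"]) auto
    qed
    show "inj_on (\<lambda>(xs, ys). word s xs \<otimes> word s' ys) (lists X \<times> lists Y)"
    proof (rule inj_onI)
      fix p q
      assume "p \<in> lists X \<times> lists Y" "q \<in> lists X \<times> lists Y"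
        and eq: "(case p of (xs, ys) \<Rightarrow> word s xs \<otimes> word s' ys) = (case q of (xs, ys) \<Rightarrow> word s xs \<otimes> word s' ys)"
      then obtain xs ys xs' ys' where a: "xs \<in> lists X" "ys \<in> lists Y" "xs' \<in> lists X" "ys' \<in> lists Y"
        "p = (xs, ys)" "q = (xs', ys')" by blast
      then show "p = q"
        using dual[OF a(1,1,2,2)] dual[OF a(1,3,2,4)] eq by (auto split: if_splits)
    qed
  qed
qed

text \<open>Letters are expanded from right to left: \<open>ws\<close> collects the basis letters
  already obtained, and multilinearity expands the last letter in front of them.\<close>

lemma word_in_span:
  fixes s :: "'k::field \<Rightarrow> 'v::ab_group_add \<Rightarrow> 'v"
  assumes s: "vector_space s" and X: "module.span s X = UNIV"
  shows "word s vs \<in> fun_vs.span {word s xs | xs. xs \<in> lists X \<and> length xs = length vs}"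
proof -
  interpret s: vector_space s by fact
  have "\<forall>ws\<in>lists X. word s (vs @ ws) \<in>
    fun_vs.span {word s xs | xs. xs \<in> lists X \<and> length xs = length vs + length ws}"
  proof (induction vs rule: rev_induct)
    case Nil
    show ?case by (auto intro: fun_vs.span_base)
  next
    case (snoc v vs)
    show ?case
    proof
      fix ws assume ws: "ws \<in> lists X"
      let ?S = "fun_vs.span {word s xs | xs. xs \<in> lists X \<and> length xs = Suc (length vs + length ws)}"
      have "v \<in> s.span X" using X by simp
      then have "word s (vs @ v # ws) \<in> ?S"
      proof (induction rule: s.span_induct_alt)
        case base
        \<comment> \<open>A word containing the letter 0 vanishes, since 0 can be pulled out as a
          scalar.\<close>
        have "word s (vs @ 0 # ws) = fscale 0 (word s (vs @ 0 # ws))"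
          using word_multilinear(2)[of s vs 0 0 ws] by simp
        then show ?case
          unfolding fun_vs.scale_zero_left by (simp only: fun_vs.span_zero)
      next
        case (step c x y)
        then have "word s (vs @ x # ws) \<in> ?S" using bspec[OF snoc, of "x # ws"] ws by simp
        with step show ?case
          unfolding word_multilinear by (intro fun_vs.span_add fun_vs.span_scale)
      qed
      then show "word s ((vs @ [v]) @ ws) \<in>
          fun_vs.span {word s xs | xs. xs \<in> lists X \<and> length xs = length (vs @ [v]) + length ws}"
        by simp
    qed
  qed
  from bspec[OF this, of "[]"] show ?thesis by simp
qed

lemma gcomp_tensor_algebra:
  assumes "vector_space s" "module.span s X = UNIV"
  shows "gcomp (tensor_algebra s) n = fun_vs.span {word s xs | xs. xs \<in> lists X \<and> length xs = n}"
proof -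
  have "word s vs \<in> fun_vs.span {word s xs | xs. xs \<in> lists X \<and> length xs = length vs}" for vs
    by (rule word_in_span[OF assms])
  then have "fun_vs.span {word s vs | vs. length vs = n} \<subseteq> fun_vs.span {word s xs | xs. xs \<in> lists X \<and> length xs = n}"
    by (intro fun_vs.span_minimal) auto
  moreover have "fun_vs.span {word s xs | xs. xs \<in> lists X \<and> length xs = n} \<subseteq> fun_vs.span {word s vs | vs. length vs = n}"
    by (intro fun_vs.span_mono) auto
  ultimately show ?thesis by (simp add: tensor_algebra_def)
qed

lemma carrier_tensor_algebra_basis:
  assumes "vector_space s" "module.span s X = UNIV"
  shows "carrier (tensor_algebra s) = fun_vs.span (word s ` lists X)"
proof (rule antisym)
  show "carrier (tensor_algebra s) \<subseteq> fun_vs.span (word s ` lists X)"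
    unfolding carrier_def gcomp_tensor_algebra[OF assms]
    by (intro fun_vs.span_minimal UN_least fun_vs.span_mono) auto
  show "fun_vs.span (word s ` lists X) \<subseteq> carrier (tensor_algebra s)"
    unfolding carrier_tensor_algebra by (intro fun_vs.span_mono) auto
qed

text \<open>Every summand contains 0, hence lies in the sum. With the next lemma this makes the sum
  of sets the least subspace containing all summands.\<close>

lemma subspace_sum_set:
  fixes V :: "'i \<Rightarrow> ('x \<Rightarrow> 'k::field) set"
  assumes "finite I" "\<And>i. i \<in> I \<Longrightarrow> fun_vs.subspace (V i)"
  shows "fun_vs.subspace (\<Sum>i\<in>I. V i) \<and> (\<forall>i\<in>I. V i \<subseteq> (\<Sum>i\<in>I. V i))"
  using assms
proof (induction I)
  case empty
  then show ?case by (simp add: set_zero fun_vs.subspace_single_0)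
next
  case (insert i I)
  let ?S = "\<Sum>i\<in>I. V i"
  have S: "fun_vs.subspace ?S" "\<forall>j\<in>I. V j \<subseteq> ?S" "fun_vs.subspace (V i)" using insert by auto
  have e: "V i + ?S = {x + y | x y. x \<in> V i \<and> y \<in> ?S}" by (auto simp: set_plus_def)
  have "fun_vs.subspace (V i + ?S)"
    unfolding e by (rule fun_vs.subspace_sums[OF S(3,1)])
  moreover have "V i \<subseteq> V i + ?S" "?S \<subseteq> V i + ?S"
    using fun_vs.subspace_0[OF S(1)] fun_vs.subspace_0[OF S(3)] set_zero_plus2 add.commute by metis+
  ultimately show ?case using insert(1,2) S(2) by simp (meson order_trans)
qed

lemma sum_set_subset:
  fixes V :: "'i \<Rightarrow> ('x \<Rightarrow> 'k::field) set"
  assumes "finite I" "\<And>i. i \<in> I \<Longrightarrow> V i \<subseteq> W" "fun_vs.subspace W"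
  shows "(\<Sum>i\<in>I. V i) \<subseteq> W"
  using assms
proof (induction I)
  case empty
  then show ?case by (simp add: set_zero fun_vs.subspace_0)
next
  case (insert i I)
  then have "V i \<subseteq> W" "(\<Sum>i\<in>I. V i) \<subseteq> W" by auto
  then show ?case using insert(1,2) fun_vs.subspace_add[OF insert.prems(2)]
    by (auto simp: set_plus_def)
qed

lemma tensor_comp_tensor_algebra:
  assumes s: "vector_space s" "module.span s X = UNIV" and s': "vector_space s'" "module.span s' Y = UNIV"
  shows "tensor_comp (tensor_algebra s) (tensor_algebra s') m =
    fun_vs.span {word s xs \<otimes> word s' ys | xs ys. xs \<in> lists X \<and> ys \<in> lists Y \<and> length xs + length ys = m}"
    (is "?L = fun_vs.span ?R")
proof -
  let ?I = "{(k, l). k + l = m}"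
  let ?V = "\<lambda>(k, l). gcomp (tensor_algebra s) k \<otimes>\<^sub>S gcomp (tensor_algebra s') l"
  have V: "?V (k, l) = fun_vs.span {word s xs \<otimes> word s' ys | xs ys.
      xs \<in> lists X \<and> ys \<in> lists Y \<and> length xs = k \<and> length ys = l}" for k l
    unfolding prod.case gcomp_tensor_algebra[OF s] gcomp_tensor_algebra[OF s'] tensor_space_span
    by (rule arg_cong[of _ _ fun_vs.span]) blast
  have fin: "finite ?I" by (rule finite_subset[of _ "{..m} \<times> {..m}"]) auto
  have sub: "fun_vs.subspace (?V i)" for i by (cases i) (simp add: subspace_tensor_space)
  note L = subspace_sum_set[of ?I ?V, OF fin sub]
  have "?L \<subseteq> fun_vs.span ?R"
    unfolding tensor_comp_def
  proof (rule sum_set_subset[OF fin _ fun_vs.subspace_span])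
    fix i assume "i \<in> ?I"
    then obtain k l where i: "i = (k, l)" "k + l = m" by auto
    show "?V i \<subseteq> fun_vs.span ?R" unfolding i V by (rule fun_vs.span_mono) (use i in auto)
  qed
  moreover have "fun_vs.span ?R \<subseteq> ?L"
  proof (rule fun_vs.span_minimal)
    show "fun_vs.subspace ?L" using L by (simp add: tensor_comp_def)
    show "?R \<subseteq> ?L"
    proof
      fix z assume "z \<in> ?R"
      then obtain xs ys where xy: "xs \<in> lists X" "ys \<in> lists Y" "length xs + length ys = m"
        "z = word s xs \<otimes> word s' ys" by blast
      then have "word s xs \<otimes> word s' ys \<in> ?V (length xs, length ys)"
        unfolding V by (intro fun_vs.span_base) blast
      then show "z \<in> ?L"
        using L xy unfolding tensor_comp_def by blast
    qed
  qed
  ultimately show ?thesis by blast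
qed

section \<open>The twisting map\<close>

text \<open>The instance \<open>BA\<close> is the same basis with the factors in the other order; it
  allows maps out of B \<otimes> A to be defined by their values on words.\<close>

locale tensor_straightening =
  straightening "\<lambda>xs ys. word sA xs \<otimes> word sB ys" X Y U D T +
  BA: free_bimodule "\<lambda>ys xs. word sB ys \<otimes> word sA xs" Y X
  for sA :: "'k::field \<Rightarrow> 'p::ab_group_add \<Rightarrow> 'p" and sB :: "'k \<Rightarrow> 'q::ab_group_add \<Rightarrow> 'q"
    and X Y U D T
begin

definition \<A> where "\<A> = fun_vs.span (word sA ` lists X)"
definition \<B> where "\<B> = fun_vs.span (word sB ` lists Y)"

definition \<tau> where "\<tau> = BA.ext twist"

lemma lin_\<tau>: "lin \<tau>"
  by (simp add: \<tau>_def BA.lin_ext)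

lemma \<tau>_word: "xs \<in> lists X \<Longrightarrow> ys \<in> lists Y \<Longrightarrow> \<tau> (word sB ys \<otimes> word sA xs) = twist ys xs"
  by (simp add: \<tau>_def BA.ext_E)

lemma word_\<A>: "xs \<in> lists X \<Longrightarrow> word sA xs \<in> \<A>"
  and word_\<B>: "ys \<in> lists Y \<Longrightarrow> word sB ys \<in> \<B>"
  by (auto simp: \<A>_def \<B>_def intro: fun_vs.span_base)

lemma subspace_\<A>: "fun_vs.subspace \<A>" and subspace_\<B>: "fun_vs.subspace \<B>"
  by (auto simp: \<A>_def \<B>_def)

lemma C_eq: "\<A> \<otimes>\<^sub>S \<B> = C"
  unfolding \<A>_def \<B>_def tensor_space_span C_def by (rule arg_cong[of _ _ fun_vs.span]) blast

lemma BA_C_eq: "\<B> \<otimes>\<^sub>S \<A> = BA.C"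
  unfolding \<A>_def \<B>_def tensor_space_span BA.C_def by (rule arg_cong[of _ _ fun_vs.span]) blast

lemma \<tau>_in: "z \<in> \<B> \<otimes>\<^sub>S \<A> \<Longrightarrow> \<tau> z \<in> \<A> \<otimes>\<^sub>S \<B>"
  unfolding C_eq BA_C_eq
  by (rule BA.C_inI[OF lin_\<tau> subspace_C]) (auto simp: \<tau>_word intro!: twist_C)

lemma linear_on_C_eqI:
  assumes "linear_on fscale fscale (\<A> \<otimes>\<^sub>S \<B>) f" "lin g" "c \<in> C"
    and "\<And>xs ys. xs \<in> lists X \<Longrightarrow> ys \<in> lists Y \<Longrightarrow> f (word sA xs \<otimes> word sB ys) = g (word sA xs \<otimes> word sB ys)"
  shows "f c = g c"
  by (rule linear_on_span_eq[OF assms(1)[unfolded C_eq C_def] linear_imp_linear_on[OF assms(2)]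
        fun_vs.vector_space_axioms _ assms(3)[unfolded C_def]]) (use assms(4) in auto)

text \<open>The composite is computed from its last factor backwards. Values of
  \<open>\<tau>\<close> are not pure tensors, so each tail of the composite must be known with an
  arbitrary \<open>c\<close> in \<open>C\<close> in the slot that receives such a value.\<close>

lemma twist_mult:
  assumes z: "z \<in> (\<B> \<otimes>\<^sub>S \<B>) \<otimes>\<^sub>S (\<A> \<otimes>\<^sub>S \<A>)"
  shows "\<tau> (tensor_map (\<B> \<otimes>\<^sub>S \<B>) (\<A> \<otimes>\<^sub>S \<A>) concat_mult concat_mult z) =
     (tensor_map (\<A> \<otimes>\<^sub>S \<A>) (\<B> \<otimes>\<^sub>S \<B>) concat_mult concat_mult
      \<circ> unreassoc
      \<circ> tensor_map \<A> ((\<B> \<otimes>\<^sub>S \<A>) \<otimes>\<^sub>S \<B>) id (tensor_map (\<B> \<otimes>\<^sub>S \<A>) \<B> \<tau> id)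
      \<circ> reassoc
      \<circ> tensor_map (\<B> \<otimes>\<^sub>S \<A>) (\<B> \<otimes>\<^sub>S \<A>) \<tau> \<tau>
      \<circ> unreassoc
      \<circ> tensor_map \<B> ((\<B> \<otimes>\<^sub>S \<A>) \<otimes>\<^sub>S \<A>) id (tensor_map (\<B> \<otimes>\<^sub>S \<A>) \<A> \<tau> id)
      \<circ> reassoc) z"
proof -
  note [simp] = subspace_\<A> subspace_\<B> subspace_tensor_space
  note [simp] = linear_on_id linear_imp_linear_on[OF lin_\<tau>] linear_imp_linear_on[OF lin_concat_mult]
    linear_imp_linear_on[OF lin_reassoc] linear_imp_linear_on[OF lin_unreassoc]
  let ?m1 = "tensor_map \<B> ((\<B> \<otimes>\<^sub>S \<A>) \<otimes>\<^sub>S \<A>) id (tensor_map (\<B> \<otimes>\<^sub>S \<A>) \<A> \<tau> id)"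
    and ?m2 = "tensor_map (\<B> \<otimes>\<^sub>S \<A>) (\<B> \<otimes>\<^sub>S \<A>) \<tau> \<tau>"
    and ?m3 = "tensor_map \<A> ((\<B> \<otimes>\<^sub>S \<A>) \<otimes>\<^sub>S \<B>) id (tensor_map (\<B> \<otimes>\<^sub>S \<A>) \<B> \<tau> id)"
    and ?m4 = "tensor_map (\<A> \<otimes>\<^sub>S \<A>) (\<B> \<otimes>\<^sub>S \<B>) concat_mult concat_mult"
    and ?m0 = "tensor_map (\<B> \<otimes>\<^sub>S \<B>) (\<A> \<otimes>\<^sub>S \<A>) concat_mult concat_mult"
  have m0: "linear_on fscale fscale ((\<B> \<otimes>\<^sub>S \<B>) \<otimes>\<^sub>S (\<A> \<otimes>\<^sub>S \<A>)) ?m0"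
    by (rule tensor_map) simp_all
  have m1: "linear_on fscale fscale (\<B> \<otimes>\<^sub>S ((\<B> \<otimes>\<^sub>S \<A>) \<otimes>\<^sub>S \<A>)) ?m1"
    by (rule tensor_map; (rule tensor_map)?) simp_all
  have m1_in: "?m1 z \<in> \<B> \<otimes>\<^sub>S ((\<A> \<otimes>\<^sub>S \<B>) \<otimes>\<^sub>S \<A>)" if "z \<in> \<B> \<otimes>\<^sub>S ((\<B> \<otimes>\<^sub>S \<A>) \<otimes>\<^sub>S \<A>)" for z
    by (rule tensor_map_in[OF _ _ _ _ _ _ that]) (auto intro!: tensor_map_in tensor_map(1) \<tau>_in)
  have m2: "linear_on fscale fscale ((\<B> \<otimes>\<^sub>S \<A>) \<otimes>\<^sub>S (\<B> \<otimes>\<^sub>S \<A>)) ?m2"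
    by (rule tensor_map) simp_all
  have m2_in: "?m2 z \<in> (\<A> \<otimes>\<^sub>S \<B>) \<otimes>\<^sub>S (\<A> \<otimes>\<^sub>S \<B>)" if "z \<in> (\<B> \<otimes>\<^sub>S \<A>) \<otimes>\<^sub>S (\<B> \<otimes>\<^sub>S \<A>)" for z
    by (rule tensor_map_in[OF _ _ _ _ _ _ that]) (auto intro!: \<tau>_in)
  have m3: "linear_on fscale fscale (\<A> \<otimes>\<^sub>S ((\<B> \<otimes>\<^sub>S \<A>) \<otimes>\<^sub>S \<B>)) ?m3"
    by (rule tensor_map; (rule tensor_map)?) simp_all
  have m3_in: "?m3 z \<in> \<A> \<otimes>\<^sub>S ((\<A> \<otimes>\<^sub>S \<B>) \<otimes>\<^sub>S \<B>)" if "z \<in> \<A> \<otimes>\<^sub>S ((\<B> \<otimes>\<^sub>S \<A>) \<otimes>\<^sub>S \<B>)" for z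
    by (rule tensor_map_in[OF _ _ _ _ _ _ that]) (auto intro!: tensor_map_in tensor_map(1) \<tau>_in)
  have m4: "linear_on fscale fscale ((\<A> \<otimes>\<^sub>S \<A>) \<otimes>\<^sub>S (\<B> \<otimes>\<^sub>S \<B>)) ?m4"
    by (rule tensor_map) simp_all
  \<comment> \<open>The tails: \<open>G4\<close> multiplies outer words onto the middle factor,
    \<open>G3\<close> is the twisted product \<open>act\<close>, \<open>G2\<close> adds the two
    parallel exchanges, and \<open>G1\<close> is the whole right-hand side.\<close>
  define G4 where "G4 = ?m4 \<circ> unreassoc"
  define G3 where "G3 = G4 \<circ> (?m3 \<circ> reassoc)"
  define G2 where "G2 = G3 \<circ> (?m2 \<circ> unreassoc)"
  define G1 where "G1 = G2 \<circ> (?m1 \<circ> reassoc)"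
  have G4: "linear_on fscale fscale (\<A> \<otimes>\<^sub>S ((\<A> \<otimes>\<^sub>S \<B>) \<otimes>\<^sub>S \<B>)) G4"
    unfolding G4_def by (rule linear_on_comp[OF _ unreassoc_in m4]) simp_all
  have G3: "linear_on fscale fscale ((\<A> \<otimes>\<^sub>S \<B>) \<otimes>\<^sub>S (\<A> \<otimes>\<^sub>S \<B>)) G3"
    unfolding G3_def
    by (rule linear_on_comp[OF linear_on_comp[OF _ reassoc_in m3] _ G4]) (auto intro!: m3_in reassoc_in)
  have G2: "linear_on fscale fscale (\<B> \<otimes>\<^sub>S ((\<A> \<otimes>\<^sub>S \<B>) \<otimes>\<^sub>S \<A>)) G2"
    unfolding G2_def
    by (rule linear_on_comp[OF linear_on_comp[OF _ unreassoc_in m2] _ G3]) (auto intro!: m2_in unreassoc_in)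
  have G1: "linear_on fscale fscale ((\<B> \<otimes>\<^sub>S \<B>) \<otimes>\<^sub>S (\<A> \<otimes>\<^sub>S \<A>)) G1"
    unfolding G1_def
    by (rule linear_on_comp[OF linear_on_comp[OF _ reassoc_in m1] _ G2]) (auto intro!: m1_in reassoc_in)
  have G4_eq: "G4 (word sA x \<otimes> (c \<otimes> word sB g)) = lmul x (rmul g c)"
    if x: "x \<in> lists X" and g: "g \<in> lists Y" and c: "c \<in> C" for x g c
  proof (rule linear_on_C_eqI[OF linear_on_tens3[OF G4] lin_comp[OF lin_lmul lin_rmul] c])
    fix xs ys assume "xs \<in> lists X" "ys \<in> lists Y"
    then show "G4 (word sA x \<otimes> ((word sA xs \<otimes> word sB ys) \<otimes> word sB g)) = lmul x (rmul g (word sA xs \<otimes> word sB ys))"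
      using x g by (simp add: G4_def unreassoc_tens tensor_map(2) tens_in_tensor_space word_\<A> word_\<B>
          concat_mult_word lmul_E rmul_E)
  qed (use x g in \<open>auto intro: word_\<A> word_\<B>\<close>)
  have G3_word: "G3 ((word sA x \<otimes> word sB g) \<otimes> (word sA y \<otimes> word sB h)) =
      act L (word sA y \<otimes> word sB h) (word sA x \<otimes> word sB g)"
    if "x \<in> lists X" "y \<in> lists X" "g \<in> lists Y" "h \<in> lists Y" for x y g h
    using that by (simp add: G3_def reassoc_tens tensor_map tens_in_tensor_space word_\<A> word_\<B> \<tau>_word
        G4_eq twist_C act_E_E)
  have G3_right: "G3 (c \<otimes> (word sA y \<otimes> word sB h)) = act L (word sA y \<otimes> word sB h) c"
    if "y \<in> lists X" "h \<in> lists Y" "c \<in> C" for c y h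
    by (rule linear_on_C_eqI[OF linear_on_tens(1)[OF G3] lin_act that(3)])
      (use that G3_word in \<open>auto intro: tens_in_tensor_space word_\<A> word_\<B>\<close>)
  \<comment> \<open>The formula is extended from words one slot at a time; the second slot relies on
    linearity of \<open>act\<close> in the element acted upon.\<close>
  have G3_eq: "G3 (c \<otimes> c') = act L c' c" if "c \<in> C" "c' \<in> C" for c c'
    by (rule linear_on_C_eqI[OF linear_on_tens(2)[OF G3] lin_act_left[OF lin_L] that(2)])
      (use that G3_right in \<open>simp_all add: C_eq\<close>)
  have G2_eq: "G2 (word sB b \<otimes> (c \<otimes> word sA a)) = ext (\<lambda>x g. act L (twist g a) (twist b x)) c"
    if b: "b \<in> lists Y" and a: "a \<in> lists X" and c: "c \<in> C" for a b c
  proof (rule linear_on_C_eqI[OF linear_on_tens3[OF G2] lin_ext c])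
    fix xs ys assume "xs \<in> lists X" "ys \<in> lists Y"
    then show "G2 (word sB b \<otimes> ((word sA xs \<otimes> word sB ys) \<otimes> word sA a)) =
        ext (\<lambda>x g. act L (twist g a) (twist b x)) (word sA xs \<otimes> word sB ys)"
      using a b by (simp add: G2_def unreassoc_tens tensor_map(2) tens_in_tensor_space word_\<A> word_\<B>
          \<tau>_word G3_eq twist_C ext_E)
  qed (use a b in \<open>auto intro: word_\<A> word_\<B>\<close>)
  \<comment> \<open>On words the law is now exactly \<open>twist_append\<close>.\<close>
  have G1_word: "G1 ((word sB b \<otimes> word sB b') \<otimes> (word sA a \<otimes> word sA a')) = twist (b @ b') (a @ a')"
    if "b \<in> lists Y" "b' \<in> lists Y" "a \<in> lists X" "a' \<in> lists X" for b b' a a'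
    using that by (simp add: G1_def reassoc_tens tensor_map tens_in_tensor_space word_\<A> word_\<B> \<tau>_word
        G2_eq twist_C twist_append)
  have span: "(\<B> \<otimes>\<^sub>S \<B>) \<otimes>\<^sub>S (\<A> \<otimes>\<^sub>S \<A>) =
      fun_vs.span {(word sB b \<otimes> word sB b') \<otimes> (word sA a \<otimes> word sA a') | b b' a a'.
        b \<in> lists Y \<and> b' \<in> lists Y \<and> a \<in> lists X \<and> a' \<in> lists X}"
    unfolding \<A>_def \<B>_def tensor_space_span by (rule arg_cong[of _ _ fun_vs.span]) blast
  have "(\<tau> \<circ> ?m0) z = G1 z"
  proof (rule linear_on_span_eq[OF _ G1[unfolded span] fun_vs.vector_space_axioms _ z[unfolded span]])
    show "linear_on fscale fscale (fun_vs.span {(word sB b \<otimes> word sB b') \<otimes> (word sA a \<otimes> word sA a') | b b' a a'.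
        b \<in> lists Y \<and> b' \<in> lists Y \<and> a \<in> lists X \<and> a' \<in> lists X}) (\<tau> \<circ> ?m0)"
      unfolding span[symmetric] by (rule linear_on_comp[OF m0, of UNIV]) simp_all
  qed (elim CollectE exE conjE,
      simp add: G1_word tensor_map(2) tens_in_tensor_space word_\<A> word_\<B> concat_mult_word \<tau>_word)
  then show ?thesis
    by (simp add: G1_def G2_def G3_def G4_def o_assoc)
qed

lemma tensor_comp_\<tau>:
  assumes "z \<in> fun_vs.span {word sB ys \<otimes> word sA xs | ys xs. ys \<in> lists Y \<and> xs \<in> lists X \<and> length ys + length xs = m}"
  shows "\<tau> z \<in> fun_vs.span {word sA xs \<otimes> word sB ys | xs ys. xs \<in> lists X \<and> ys \<in> lists Y \<and> length xs + length ys = m}"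
    (is "_ \<in> fun_vs.span ?R")
proof (rule lin_span_in[OF lin_\<tau> fun_vs.subspace_span assms])
  fix b assume "b \<in> {word sB ys \<otimes> word sA xs | ys xs. ys \<in> lists Y \<and> xs \<in> lists X \<and> length ys + length xs = m}"
  then obtain xs ys where "xs \<in> lists X" "ys \<in> lists Y" "b = word sB ys \<otimes> word sA xs" "length ys + length xs = m"
    by auto
  then have "\<tau> b \<in> K m m" using twist_K[of xs ys] by (simp add: \<tau>_word)
  also have "K m m \<subseteq> fun_vs.span ?R"
    unfolding K_def by (rule fun_vs.span_mono) blast
  finally show "\<tau> b \<in> fun_vs.span ?R" .
qed

lemma graded_twisting_map_\<tau>:
  assumes sA: "vector_space sA" "module.span sA X = UNIV" and sB: "vector_space sB" "module.span sB Y = UNIV"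
  shows "graded_twisting_map (tensor_algebra sA) (tensor_algebra sB) \<tau>"
proof -
  have car: "carrier (tensor_algebra sA) = \<A>" "carrier (tensor_algebra sB) = \<B>"
    by (simp_all add: carrier_tensor_algebra_basis[OF sA] carrier_tensor_algebra_basis[OF sB] \<A>_def \<B>_def)
  have alg: "unit (tensor_algebra sA) = word sA []" "unit (tensor_algebra sB) = word sB []"
    "mult (tensor_algebra sA) = concat_mult" "mult (tensor_algebra sB) = concat_mult"
    by (simp_all add: tensor_algebra_def)
  have "\<tau> (word sB [] \<otimes> a) = a \<otimes> word sB []" if "a \<in> \<A>" for a
    by (rule lin_span_eq[OF lin_comp[OF lin_\<tau> lin_tens_right] lin_tens_left that[unfolded \<A>_def]])
      (auto simp: \<tau>_word twist_Nil in_lists_conv_set)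
  moreover have "\<tau> (b \<otimes> word sA []) = word sA [] \<otimes> b" if "b \<in> \<B>" for b
    by (rule lin_span_eq[OF lin_comp[OF lin_\<tau> lin_tens_left] lin_tens_right that[unfolded \<B>_def]])
      (auto simp: \<tau>_word twist_unit in_lists_conv_set)
  ultimately show ?thesis
    unfolding graded_twisting_map_def Let_def car alg
      tensor_comp_tensor_algebra[OF sA sB] tensor_comp_tensor_algebra[OF sB sA]
    using \<tau>_in linear_imp_linear_on[OF lin_\<tau>] tensor_comp_\<tau> twist_mult
    by (intro conjI allI ballI image_subsetI) blast+
qed

end

section \<open>From the hypotheses on \<open>t\<close> to straightening data\<close>

lemma degree1_span_subset:
  assumes "vector_space s"
  shows "degree1_span s X \<subseteq> fun_vs.span ((\<lambda>v. word s [v]) ` X)"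
proof -
  interpret s: vector_space s by fact
  have l: "word s [x + y] = word s [x] + word s [y]" "word s [s c x] = fscale c (word s [x])" for x y c
    using word_multilinear[of s "[]"] by auto
  have "word s [v] \<in> fun_vs.span ((\<lambda>v. word s [v]) ` X)" if "v \<in> s.span X" for v
    using that
  proof (induction rule: s.span_induct_alt)
    case base
    have "word s [0] = fscale 0 (word s [0])" using l(2)[of 0 0] by simp
    then show ?case
      unfolding fun_vs.scale_zero_left by (simp only: fun_vs.span_zero)
  next
    case (step c x y)
    then show ?case unfolding l by (intro fun_vs.span_add fun_vs.span_scale) (auto intro: fun_vs.span_base)
  qed
  then show ?thesis by (auto simp: degree1_span_def)
qed

lemma word_in_degree1_span:
  assumes "vector_space s" "x \<in> X" shows "word s [x] \<in> degree1_span s X"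
proof -
  interpret s: vector_space s by fact
  show ?thesis unfolding degree1_span_def using assms(2) s.span_base by blast
qed

lemma tensor_space_mono: "V \<subseteq> V' \<Longrightarrow> W \<subseteq> W' \<Longrightarrow> V \<otimes>\<^sub>S W \<subseteq> V' \<otimes>\<^sub>S W'"
  unfolding tensor_space_def by (rule fun_vs.span_mono) blast

lemma span_plus_subset:
  assumes "V \<subseteq> fun_vs.span S" "W \<subseteq> fun_vs.span S'"
  shows "V + W \<subseteq> fun_vs.span (S \<union> S')"
proof (rule subsetI, elim set_plus_elim)
  fix x a b assume "x = a + b" "a \<in> V" "b \<in> W"
  moreover have "fun_vs.span S \<subseteq> fun_vs.span (S \<union> S')" "fun_vs.span S' \<subseteq> fun_vs.span (S \<union> S')"
    by (simp_all add: fun_vs.span_mono)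
  ultimately show "x \<in> fun_vs.span (S \<union> S')" using assms fun_vs.span_add by blast
qed

theorem theorem3p6:
  fixes scaleA :: "'k::field \<Rightarrow> 'p::ab_group_add \<Rightarrow> 'p"
    and scaleB :: "'k \<Rightarrow> 'q::ab_group_add \<Rightarrow> 'q"
    and basisA :: "'p set"
    and us ds :: "'q list"
    and t :: "((('q \<Rightarrow> 'k) list \<times> ('p \<Rightarrow> 'k) list) \<Rightarrow> 'k) \<Rightarrow> (('p \<Rightarrow> 'k) list \<times> ('q \<Rightarrow> 'k) list) \<Rightarrow> 'k"
    and A :: "(('p \<Rightarrow> 'k) list, 'k) graded_algebra"
    and B :: "(('q \<Rightarrow> 'k) list, 'k) graded_algebra"
  assumes A1: "finite_dimensional_vector_space scaleA basisA"
    and B1: "finite_dimensional_vector_space scaleB (set (us @ ds))" "distinct (us @ ds)"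
    and A: "A = tensor_algebra scaleA"
    and B: "B = tensor_algebra scaleB"
    and B': "B' = degree1_span scaleB (set us)"
    and B'': "B'' = degree1_span scaleB (set ds)"
    and t_lin: "linear_on fscale fscale (gcomp B 1 \<otimes>\<^sub>S gcomp A 1) t"
    and t_into: "t ` (gcomp B 1 \<otimes>\<^sub>S gcomp A 1) \<subseteq> carrier A \<otimes>\<^sub>S carrier B"
    and t_u: "t ` (B' \<otimes>\<^sub>S gcomp A 1) \<subseteq> gcomp A 1 \<otimes>\<^sub>S B' + gcomp A 2 \<otimes>\<^sub>S gcomp B 0"
    and t_d: "t ` (B'' \<otimes>\<^sub>S gcomp A 1)
               \<subseteq> gcomp A 1 \<otimes>\<^sub>S B'' + gcomp A 0 \<otimes>\<^sub>S (mult B ` (gcomp B 1 \<otimes>\<^sub>S B''))"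
  shows "\<exists>\<tau>. graded_twisting_map A B \<tau> \<and> (\<forall>x \<in> gcomp B 1 \<otimes>\<^sub>S gcomp A 1. \<tau> x = t x)"
proof -
  let ?X = basisA and ?U = "set us" and ?D = "set ds" and ?Y = "set (us @ ds)"
  let ?wA = "word scaleA" and ?wB = "word scaleB"
  interpret VA: finite_dimensional_vector_space scaleA basisA by fact
  interpret VB: finite_dimensional_vector_space scaleB "set (us @ ds)" by fact
  note vA = VA.vector_space_axioms VA.span_Basis and vB = VB.vector_space_axioms VB.span_Basis
  note gA = gcomp_tensor_algebra[OF vA, folded A] and gB = gcomp_tensor_algebra[OF vB, folded B]
  have gA0: "gcomp A 0 = fun_vs.span {?wA []}" and gB0: "gcomp B 0 = fun_vs.span {?wB []}"
    unfolding gA gB by (rule arg_cong[of _ _ fun_vs.span], auto)+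
  have gA1: "gcomp A 1 = fun_vs.span {?wA [a] | a. a \<in> ?X}" and gB1: "gcomp B 1 = fun_vs.span {?wB [y] | y. y \<in> ?Y}"
    unfolding gA gB by (rule arg_cong[of _ _ fun_vs.span], force simp: length_Suc_conv)+
  have gA2: "gcomp A 2 = fun_vs.span {?wA [a, a'] | a a'. a \<in> ?X \<and> a' \<in> ?X}"
    unfolding gA by (rule arg_cong[of _ _ fun_vs.span]) (force simp: length_Suc_conv numeral_2_eq_2)
  have B'_sub: "B' \<subseteq> fun_vs.span {?wB [v] | v. v \<in> ?U}" and B''_sub: "B'' \<subseteq> fun_vs.span {?wB [v] | v. v \<in> ?D}"
    using degree1_span_subset[OF vB(1)] by (simp_all add: B' B'' Setcompr_eq_image)
  \<comment> \<open>Concatenation turns the products of B_1 with B'' into two-letter words whose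
    second letter is one of the \<open>ds\<close>, the quadratic terms that the recursion can
    handle.\<close>
  have mult_sub: "mult B ` (gcomp B 1 \<otimes>\<^sub>S B'') \<subseteq> fun_vs.span {?wB [y, v] | y v. y \<in> ?Y \<and> v \<in> ?D}"
    (is "_ \<subseteq> fun_vs.span ?S")
  proof (rule image_subsetI)
    fix z assume "z \<in> gcomp B 1 \<otimes>\<^sub>S B''"
    also have "\<dots> \<subseteq> fun_vs.span {?wB [y] \<otimes> ?wB [v] | y v. y \<in> ?Y \<and> v \<in> ?D}"
      by (rule order_trans[OF tensor_space_mono[OF order_refl B''_sub]],
          unfold gB1 tensor_space_span, rule fun_vs.span_mono) blast
    finally have "concat_mult z \<in> fun_vs.span ?S"
      by (rule lin_span_in[OF lin_concat_mult fun_vs.subspace_span])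
        (elim CollectE exE conjE, simp only: concat_mult_word append.simps, rule fun_vs.span_base, blast)
    then show "mult B z \<in> fun_vs.span ?S" by (simp add: B tensor_algebra_def)
  qed
  \<comment> \<open>Only the values of \<open>t\<close> at pairs of basis vectors enter the
    construction.\<close>
  let ?T = "\<lambda>y x. t (?wB [y] \<otimes> ?wA [x])"
  have wA: "?wA [x] \<in> gcomp A 1" if "x \<in> ?X" for x
    unfolding gA1 using that by (intro fun_vs.span_base) auto
  interpret tensor_straightening scaleA scaleB ?X ?Y ?U ?D ?T
  proof (intro tensor_straightening.intro straightening.intro straightening_axioms.intro)
    show "free_bimodule (\<lambda>xs ys. ?wA xs \<otimes> ?wB ys) ?X ?Y"
      by (rule free_bimodule_words[OF vA(1) VA.independent_Basis vB(1) VB.independent_Basis])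
    show "free_bimodule (\<lambda>ys xs. ?wB ys \<otimes> ?wA xs) ?Y ?X"
      by (rule free_bimodule_words[OF vB(1) VB.independent_Basis vA(1) VA.independent_Basis])
    show "?Y = ?U \<union> ?D" by simp
  next
    fix u x assume u: "u \<in> ?U" "x \<in> ?X"
    have "?T u x \<in> gcomp A 1 \<otimes>\<^sub>S B' + gcomp A 2 \<otimes>\<^sub>S gcomp B 0"
      using t_u tens_in_tensor_space[OF word_in_degree1_span[OF vB(1) u(1), folded B'] wA[OF u(2)]] by blast
    also have "\<dots> \<subseteq> fun_vs.span ({?wA [a] \<otimes> ?wB [v] | a v. a \<in> ?X \<and> v \<in> ?U}
        \<union> {?wA [a, a'] \<otimes> ?wB [] | a a'. a \<in> ?X \<and> a' \<in> ?X})"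
      by (intro span_plus_subset order_trans[OF tensor_space_mono[OF order_refl B'_sub]];
          unfold gA1 gA2 gB0 tensor_space_span; intro fun_vs.span_mono; blast)
    finally show "?T u x \<in> \<dots>" .
  next
    fix d x assume d: "d \<in> ?D" "x \<in> ?X"
    have "?T d x \<in> gcomp A 1 \<otimes>\<^sub>S B'' + gcomp A 0 \<otimes>\<^sub>S (mult B ` (gcomp B 1 \<otimes>\<^sub>S B''))"
      using t_d tens_in_tensor_space[OF word_in_degree1_span[OF vB(1) d(1), folded B''] wA[OF d(2)]] by blast
    also have "\<dots> \<subseteq> fun_vs.span ({?wA [a] \<otimes> ?wB [v] | a v. a \<in> ?X \<and> v \<in> ?D}
        \<union> {?wA [] \<otimes> ?wB [y, v] | y v. y \<in> ?Y \<and> v \<in> ?D})"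
      by (intro span_plus_subset order_trans[OF tensor_space_mono[OF order_refl B''_sub]]
          order_trans[OF tensor_space_mono[OF order_refl mult_sub]];
          unfold gA1 gA0 tensor_space_span; intro fun_vs.span_mono; blast)
    finally show "?T d x \<in> \<dots>" .
  qed
  \<comment> \<open>Both maps are linear, and on pairs of basis vectors they agree by
    \<open>twist_single\<close>.\<close>
  have "\<tau> x = t x" if "x \<in> gcomp B 1 \<otimes>\<^sub>S gcomp A 1" for x
    by (rule linear_on_span_eq[OF linear_imp_linear_on[OF lin_\<tau>] t_lin[unfolded gA1 gB1 tensor_space_span]
          fun_vs.vector_space_axioms _ that[unfolded gA1 gB1 tensor_space_span]])
      (auto simp: \<tau>_word twist_single simp del: set_append)
  then show ?thesis
    using graded_twisting_map_\<tau>[OF vA vB] by (auto simp: A B)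
qed

end
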